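(* Fix $\varepsilon>0$. For the random graph $G_{n,p}$ with edge-probability $p=p(n)$, set $\varphi=\varphi(n,p):=n(1-p)$. (i) If $n^{-o(1)}\le\varphi\ll\log n$, then no interval of length $\lfloor n^{1/2-\varepsilon}\rfloor$ contains $\chi(G_{n,p})$ with high probability. (ii) If $\log n\ll\varphi\le n^{o(1)}$, then there is an interval of length $\lfloor n^{\varepsilon}\rfloor$ that contains $\chi(G_{n,p})$ with high probability.
   Context: $G_{n,p}$ denotes the binomial random graph on vertex set $[n]$ in which each pair of vertices is an edge independently with probability $p$; $\chi$ denotes the chromatic number. For positive functions, $a\ll b$ means $a/b\to0$ as $n\to\infty$; $\varphi\ge n^{-o(1)}$ means $\varphi\ge n^{-\eta(n)}$ for some $\eta(n)\to0$, and $\varphi\le n^{o(1)}$ means $\varphi\le n^{\eta(n)}$ for some $\eta(n)\to 0$. "With high probability" means with probability tending to $1$ as $n\to\infty$. "There is an interval of length $\ell(n)$ that contains $\chi(G_{n,p})$ with high probability" means there exist intervals $I_n$ of length $\ell(n)$ with $\Pr(\chi(G_{n,p})\in I_n)\to1$; "no interval of length $\ell(n)$ contains $\chi(G_{n,p})$ with high probability" means there is no such sequence of intervals. *)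

theory Defs
  imports "HOL-Probability.Probability"
begin

text \<open>The binomial random graph G(n,p) on vertex set {0..<n} (a relabelling of [n]),
  represented by its edge set (a set of 2-element vertex sets). Each pair (i,j), i<j<n,
  is an edge independently with probability p.\<close>
definition gnp :: "nat \<Rightarrow> real \<Rightarrow> nat set set pmf" where
  "gnp n p = map_pmf (\<lambda>f. {{i, j} | i j. i < j \<and> j < n \<and> f (i, j)})
     (Pi_pmf {(i, j). i < j \<and> j < n} False (\<lambda>_. bernoulli_pmf p))"

definition proper_colouring :: "nat \<Rightarrow> nat set set \<Rightarrow> nat \<Rightarrow> (nat \<Rightarrow> nat) \<Rightarrow> bool" where
  "proper_colouring n E k c \<longleftrightarrow>
     (\<forall>v<n. c v < k) \<and> (\<forall>u<n. \<forall>v<n. u \<noteq> v \<longrightarrow> {u, v} \<in> E \<longrightarrow> c u \<noteq> c v)"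

definition chromatic_number :: "nat \<Rightarrow> nat set set \<Rightarrow> nat" where
  "chromatic_number n E = (LEAST k. \<exists>c. proper_colouring n E k c)"

end

theory Submission
  imports Defs "HOL-Real_Asymp.Real_Asymp"
begin

text \<open>
  Let \<open>H\<close> be the complement graph, a binomial random graph with edge probability \<open>q = 1 - p = \<phi> / n\<close>,
  so that colour classes are cliques of \<open>H\<close>.

  If \<open>\<phi>\<close> is much larger than \<open>log n\<close>, a union bound over the violations of Hall's condition shows
  that \<open>H\<close> has a matching of size \<open>\<lfloor>n / 2\<rfloor>\<close>, whence the chromatic number is at most \<open>(n + 1) / 2\<close>. It is at
  least \<open>(n - T) / 2\<close>, where \<open>T\<close> counts the triangles of \<open>H\<close>, and the mean of \<open>T\<close> is at most
  \<open>\<phi>\<^sup>3 = n\<^bsup>o(1)\<^esup>\<close>.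

  If \<open>\<phi>\<close> is much smaller than \<open>log n\<close>, add to \<open>H\<close> every non-edge with probability \<open>\<rho> = sqrt q / n\<close>.
  By the Cauchy-Schwarz inequality applied to the likelihood ratio, the enlarged graph is contiguous
  to \<open>H\<close>, so any interval that contains the chromatic number of one with high probability contains
  that of the other. But \<open>H\<close> has \<open>n\<^bsup>1 - o(1)\<^esup>\<close> isolated vertices, so (second moment) about
  \<open>n\<^sup>2 \<rho> exp (- 2 \<phi>) = n\<^bsup>1/2 - o(1)\<^esup>\<close> new edges are isolated edges of the enlarged graph, and each of
  them decreases the chromatic number by one.
\<close>

section \<open>Hall's theorem\<close>

text \<open>Halmos-Vaughan induction. If some nonempty proper subset is tight, it and its complement
  are matched separately, the complement avoiding all neighbours of the tight set. Otherwise every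
  nonempty proper subset has a neighbour to spare, so any one element may be matched arbitrarily and
  removed.\<close>

lemma hall_marriage:
  assumes "finite S" "\<And>x. x \<in> S \<Longrightarrow> finite (N x)"
    and "\<And>X. X \<subseteq> S \<Longrightarrow> card X \<le> card (\<Union>x\<in>X. N x)"
  shows "\<exists>f. inj_on f S \<and> (\<forall>x\<in>S. f x \<in> N x)"
  using assms
proof (induction S arbitrary: N rule: finite_psubset_induct)
  case (psubset S)
  note fin = psubset.prems(1) and hall = psubset.prems(2)
  show ?case
  proof (cases "\<exists>X. X \<noteq> {} \<and> X \<subset> S \<and> card (\<Union>x\<in>X. N x) \<le> card X")
    case True
    then obtain X where X: "X \<noteq> {}" "X \<subset> S" "card (\<Union>x\<in>X. N x) \<le> card X" by blast
    have finX: "finite X" using X psubset.hyps finite_subset by blast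
    have "\<exists>f. inj_on f X \<and> (\<forall>x\<in>X. f x \<in> N x)"
      by (rule psubset.IH[OF X(2)]) (use X(2) fin hall in auto)
    then obtain f where f: "inj_on f X" "\<forall>x\<in>X. f x \<in> N x" by blast
    \<comment> \<open>Hall's condition survives in \<open>N'\<close>: it holds for
      \<open>X \<union> Y\<close>, and tightness of \<open>X\<close> bounds what is
      subtracted.\<close>
    define N' where "N' x = N x - (\<Union>x\<in>X. N x)" for x
    have "\<exists>g. inj_on g (S - X) \<and> (\<forall>x\<in>S - X. g x \<in> N' x)"
    proof (rule psubset.IH)
      show "S - X \<subset> S" using X by auto
      show "finite (N' x)" if "x \<in> S - X" for x using fin that by (auto simp: N'_def)
      fix Y assume Y: "Y \<subseteq> S - X"
      have "finite Y" using Y psubset.hyps finite_subset by blast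
      then have "card X + card Y = card (X \<union> Y)" 
        using Y finX by (subst card_Un_disjoint) auto
      also have "\<dots> \<le> card (\<Union>x\<in>X \<union> Y. N x)" using Y X by (intro hall) auto
      also have "(\<Union>x\<in>X \<union> Y. N x) = (\<Union>x\<in>X. N x) \<union> (\<Union>x\<in>Y. N' x)" by (auto simp: N'_def)
      also have "card \<dots> \<le> card (\<Union>x\<in>X. N x) + card (\<Union>x\<in>Y. N' x)" by (rule card_Un_le)
      finally show "card Y \<le> card (\<Union>x\<in>Y. N' x)" using X(3) by simp
    qed
    then obtain g where g: "inj_on g (S - X)" "\<forall>x\<in>S - X. g x \<in> N' x" by auto
    define h where "h x = (if x \<in> X then f x else g x)" for x
    have cross: "g x \<noteq> f y" if "x \<in> S - X" "y \<in> X" for x y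
      using g(2) f(2) that unfolding N'_def by (metis DiffD2 UN_I)
    have "h x \<noteq> h y" if "x \<in> S" "y \<in> S" "x \<noteq> y" for x y
      using that cross[of x y] cross[of y x] inj_onD[OF g(1), of x y] inj_onD[OF f(1), of x y]
      by (cases "x \<in> X"; cases "y \<in> X") (auto simp: h_def)
    then have "inj_on h S" by (meson inj_onI)
    moreover have "\<forall>x\<in>S. h x \<in> N x" using f g by (auto simp: h_def N'_def)
    ultimately show ?thesis by blast
  next
    case no_tight: False
    show ?thesis
    proof (cases "S = {}")
      case True then show ?thesis by simp
    next
      case nonempty: False
      then obtain x where x: "x \<in> S" by blast
      have "card {x} \<le> card (N x)" using hall[of "{x}"] x by simp
      then obtain y where y: "y \<in> N x" by fastforce
      have "\<exists>g. inj_on g (S - {x}) \<and> (\<forall>z\<in>S - {x}. g z \<in> N z - {y})"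
      proof (rule psubset.IH)
        show "S - {x} \<subset> S" using x by auto
        show "finite (N z - {y})" if "z \<in> S - {x}" for z using fin that by auto
        fix Y assume Y: "Y \<subseteq> S - {x}"
        show "card Y \<le> card (\<Union>z\<in>Y. N z - {y})"
        proof (cases "Y = {}")
          case False
          moreover have "Y \<subset> S" using Y x by auto
          ultimately have "card Y < card (\<Union>z\<in>Y. N z)"
            using no_tight not_le by blast
          \<comment> \<open>The strict inequality for proper subsets pays for the loss of the single
            element \<open>y\<close>.\<close>
          moreover have "card (\<Union>z\<in>Y. N z) - 1 \<le> card ((\<Union>z\<in>Y. N z) - {y})"
            by (simp add: card_Diff_singleton_if)
          moreover have "(\<Union>z\<in>Y. N z - {y}) = (\<Union>z\<in>Y. N z) - {y}" by auto
          ultimately show ?thesis by simp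
        qed simp
      qed
      then obtain g where g: "inj_on g (S - {x})" "\<forall>z\<in>S - {x}. g z \<in> N z - {y}" by blast
      have "inj_on (g(x := y)) S"
        using g by (auto simp: inj_on_def)
      moreover have "\<forall>z\<in>S. (g(x := y)) z \<in> N z" using g y by auto
      ultimately show ?thesis by blast
    qed
  qed
qed

section \<open>Chromatic number\<close>

text \<open>Colours of any type can be relabelled by an initial segment of the naturals, so only the
  number of colours used matters.\<close>

lemma chromatic_number_le_card_image:
  fixes c :: "nat \<Rightarrow> 'a"
  assumes "\<And>u v. u < n \<Longrightarrow> v < n \<Longrightarrow> u \<noteq> v \<Longrightarrow> {u, v} \<in> E \<Longrightarrow> c u \<noteq> c v"
  shows "chromatic_number n E \<le> card (c ` {..<n})"
proof -
  obtain g where g: "bij_betw g (c ` {..<n}) {0..<card (c ` {..<n})}"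
    using ex_bij_betw_finite_nat[of "c ` {..<n}"] by auto
  have "proper_colouring n E (card (c ` {..<n})) (g \<circ> c)"
    unfolding proper_colouring_def
  proof (intro conjI allI impI)
    fix v assume "v < n"
    then show "(g \<circ> c) v < card (c ` {..<n})" using bij_betwE[OF g] by auto
  next
    fix u v assume "u < n" "v < n" "u \<noteq> v" "{u, v} \<in> E"
    then show "(g \<circ> c) u \<noteq> (g \<circ> c) v"
      using assms bij_betw_imp_inj_on[OF g] by (auto simp: inj_on_def)
  qed
  then show ?thesis unfolding chromatic_number_def by (intro Least_le) blast
qed

lemma chromatic_number_attained: "\<exists>c. proper_colouring n E (chromatic_number n E) c"
proof -
  have "proper_colouring n E n id" by (auto simp: proper_colouring_def)
  then show ?thesis unfolding chromatic_number_def
    by (rule LeastI2[where P = "\<lambda>k. \<exists>c. proper_colouring n E k c", OF exI])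
qed

text \<open>Each \<open>j\<close> in \<open>J\<close> and its partner \<open>\<pi> j\<close> are
  alone in their colour classes and not adjacent. Giving \<open>j\<close> the colour of its partner
  stays proper and frees the colour \<open>c j\<close>, one for every element of
  \<open>J\<close>.\<close>

lemma chromatic_number_merge:
  assumes c: "\<And>v. v < n \<Longrightarrow> c v < k"
    and proper: "\<And>u v. u < n \<Longrightarrow> v < n \<Longrightarrow> u \<noteq> v \<Longrightarrow> {u, v} \<in> E \<Longrightarrow> c u \<noteq> c v"
    and J: "J \<subseteq> {..<n}" "inj_on \<pi> J" "\<pi> ` J \<subseteq> {..<n} - J"
    and uniq: "\<And>j v. j \<in> J \<Longrightarrow> v < n \<Longrightarrow> c v = c j \<Longrightarrow> v = j"
    and uniq': "\<And>j v. j \<in> J \<Longrightarrow> v < n \<Longrightarrow> c v = c (\<pi> j) \<Longrightarrow> v = \<pi> j"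
    and nonadj: "\<And>j. j \<in> J \<Longrightarrow> {j, \<pi> j} \<notin> E"
  shows "chromatic_number n E + card J \<le> k"
proof -
  define c' where "c' v = (if v \<in> J then c (\<pi> v) else c v)" for v
  have "finite J" using J(1) finite_subset by blast
  have inj: "inj_on c J" using uniq J(1) by (auto simp: inj_on_def)
  have "chromatic_number n E \<le> card (c' ` {..<n})"
  proof (rule chromatic_number_le_card_image)
    fix u v assume uv: "u < n" "v < n" "u \<noteq> v" "{u, v} \<in> E"
    have *: "c' a \<noteq> c' b" if "a < n" "b < n" "a \<in> J" "b \<notin> J" "{a, b} \<in> E" for a b
      using uniq'[of a b] nonadj[of a] that by (auto simp: c'_def)
    \<comment> \<open>Equal new colours would mean a common partner, against injectivity of
      \<open>\<pi>\<close>.\<close>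
    have **: "c' u \<noteq> c' v" if "u \<in> J" "v \<in> J"
    proof
      assume "c' u = c' v"
      then have "\<pi> u = \<pi> v" using uniq'[of v "\<pi> u"] that J(3) by (auto simp: c'_def)
      then show False using that J(2) uv(3) by (auto simp: inj_on_def)
    qed
    show "c' u \<noteq> c' v"
      using *[of u v] *[of v u] ** uv proper[OF uv]
      by (cases "u \<in> J"; cases "v \<in> J") (auto simp: insert_commute c'_def)
  qed
  also have "c' ` {..<n} \<subseteq> {..<k} - c ` J"
  proof
    fix x assume "x \<in> c' ` {..<n}"
    then obtain v where v: "v < n" "x = c' v" by auto
    define w where "w = (if v \<in> J then \<pi> v else v)"
    have w: "w < n" "w \<notin> J" "x = c w" using v J(3) by (auto simp: w_def c'_def)
    then show "x \<in> {..<k} - c ` J" using c uniq by auto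
  qed
  then have "card (c' ` {..<n}) \<le> card ({..<k} - c ` J)" by (intro card_mono) auto
  also have "\<dots> = k - card J"
    using c J(1) \<open>finite J\<close> inj by (subst card_Diff_subset) (auto simp: card_image)
  finally have "chromatic_number n E \<le> k - card J" .
  moreover have "card J \<le> k"
    using card_mono[of "{..<k}" "c ` J"] c J(1) by (auto simp: card_image[OF inj])
  ultimately show ?thesis by simp
qed

text \<open>These are the triangles of the complement graph, each listed once in increasing
  order.\<close>

definition indep_triples :: "nat \<Rightarrow> nat set set \<Rightarrow> (nat \<times> nat \<times> nat) set" where
  "indep_triples n E =
     {(a, b, v). a < b \<and> b < v \<and> v < n \<and> {a, b} \<notin> E \<and> {a, v} \<notin> E \<and> {b, v} \<notin> E}"

text \<open>In every colour class all vertices but the two smallest ones are the largest element of an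
  independent triple.\<close>

lemma order_le_twice_chromatic_number:
  "n \<le> 2 * chromatic_number n E + card (indep_triples n E)"
proof -
  define k where "k = chromatic_number n E"
  obtain c where c: "proper_colouring n E k c"
    using chromatic_number_attained unfolding k_def by blast
  have col: "c v < k" if "v < n" for v using c that by (auto simp: proper_colouring_def)
  have nonadj: "{u, v} \<notin> E" if "u < n" "v < n" "u \<noteq> v" "c u = c v" for u v
    using c that by (auto simp: proper_colouring_def)
  define W where "W = {v. v < n \<and> (\<exists>a b. a < b \<and> b < v \<and> c a = c v \<and> c b = c v)}"
  have fin: "finite (indep_triples n E)"
    by (rule finite_subset[of _ "{..<n} \<times> {..<n} \<times> {..<n}"]) (auto simp: indep_triples_def)
  have "W \<subseteq> (\<lambda>(a, b, v). v) ` indep_triples n E"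
  proof
    fix v assume "v \<in> W"
    then obtain a b where "a < b" "b < v" "v < n" "c a = c v" "c b = c v" by (auto simp: W_def)
    then have "(a, b, v) \<in> indep_triples n E"
      using nonadj[of a b] nonadj[of a v] nonadj[of b v] by (auto simp: indep_triples_def)
    then show "v \<in> (\<lambda>(a, b, v). v) ` indep_triples n E" by force
  qed
  then have 1: "card W \<le> card (indep_triples n E)"
    by (rule surj_card_le[OF fin])
  \<comment> \<open>Outside \<open>W\<close> a colour class keeps at most two vertices; the bit
    tells its smallest vertex from the second one.\<close>
  define g where "g v = (c v, \<exists>a<v. c a = c v)" for v
  have "inj_on g ({..<n} - W)"
  proof (rule linorder_inj_onI)
    fix v w assume *: "v < w" "v \<in> {..<n} - W" "w \<in> {..<n} - W"
    show "g v \<noteq> g w"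
    proof
      assume eq: "g v = g w"
      then have "\<exists>a<w. c a = c w" using * by (auto simp: g_def)
      then obtain a where "a < v" "c a = c v" using eq by (auto simp: g_def)
      then show False using * eq by (auto simp: W_def g_def)
    qed
  qed auto
  moreover have "g ` ({..<n} - W) \<subseteq> {..<k} \<times> UNIV" using col by (auto simp: g_def)
  ultimately have "card ({..<n} - W) \<le> card ({..<k} \<times> (UNIV :: bool set))"
    by (intro card_inj_on_le) auto
  then have "card ({..<n} - W) \<le> 2 * k" by (simp add: card_cartesian_product)
  moreover have "n \<le> card ({..<n} - W) + card W"
    using card_Un_le[of "{..<n} - W" W] card_mono[of "({..<n} - W) \<union> W" "{..<n}"]
    by (auto simp: W_def)
  ultimately show ?thesis using 1 unfolding k_def by linarith
qed

section \<open>Graphs as indicator functions on pairs, and matchings in the complement\<close>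

definition edges_of :: "nat \<Rightarrow> (nat \<times> nat \<Rightarrow> bool) \<Rightarrow> nat set set" where
  "edges_of n f = {{i, j} | i j. i < j \<and> j < n \<and> f (i, j)}"

definition vpairs :: "nat \<Rightarrow> (nat \<times> nat) set" where
  "vpairs n = {(i, j). i < j \<and> j < n}"

lemma gnp_eq_map_edges_of:
  "gnp n p = map_pmf (edges_of n) (Pi_pmf (vpairs n) False (\<lambda>_. bernoulli_pmf p))"
  by (simp add: gnp_def edges_of_def [abs_def] vpairs_def)

lemma finite_vpairs [simp]: "finite (vpairs n)"
  by (rule finite_subset[of _ "{..<n} \<times> {..<n}"]) (auto simp: vpairs_def)

lemma edge_iff: "u < v \<Longrightarrow> {u, v} \<in> edges_of n f \<longleftrightarrow> v < n \<and> f (u, v)"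
  by (auto simp: edges_of_def doubleton_eq_iff)

lemma edge_iff': "u < v \<Longrightarrow> {v, u} \<in> edges_of n f \<longleftrightarrow> v < n \<and> f (u, v)"
  using edge_iff[of u v n f] by (simp add: insert_commute)

text \<open>Here \<open>h\<close> is a matching of size \<open>m\<close> in the complement graph,
  between the first \<open>m\<close> vertices and the next \<open>m\<close>. Starting from all
  colours distinct, merging along it saves \<open>m\<close> colours.\<close>

lemma chromatic_number_le_bipartite:
  assumes "2 * m \<le> n" "inj_on h {..<m}" "\<And>i. i < m \<Longrightarrow> h i \<in> {m..<2 * m} \<and> \<not> f (i, h i)"
  shows "chromatic_number n (edges_of n f) \<le> n - m"
proof -
  have "chromatic_number n (edges_of n f) + card {..<m} \<le> n"
  proof (rule chromatic_number_merge[where c = id and \<pi> = h])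
    fix j assume "j \<in> {..<m}"
    then show "{j, h j} \<notin> edges_of n f" using assms(3)[of j] by (auto simp: edge_iff)
  qed (use assms in \<open>auto, fastforce+\<close>)
  then show ?thesis by simp
qed

text \<open>A violation \<open>X\<close> of Hall's condition in the bipartite complement is
  completely joined in the graph to everything outside its neighbourhood there. That outside set has
  at least \<open>Suc m - card X\<close> elements and is trimmed to this size, so that the union
  bound later ranges over one parameter only.\<close>

lemma complete_pair_of_no_matching:
  assumes "\<not> (\<exists>h. inj_on h {..<m} \<and> (\<forall>i<m. h i \<in> {m..<2 * m} \<and> \<not> f (i, h i)))"
  shows "\<exists>S T. S \<subseteq> {..<m} \<and> T \<subseteq> {m..<2 * m} \<and> card S + card T = Suc m \<and>
    (\<forall>i\<in>S. \<forall>j\<in>T. f (i, j))"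
proof -
  define N where "N i = {j \<in> {m..<2 * m}. \<not> f (i, j)}" for i
  have "\<exists>X. X \<subseteq> {..<m} \<and> card (\<Union>x\<in>X. N x) < card X"
  proof (rule ccontr)
    assume "\<not> ?thesis"
    then have "\<exists>h. inj_on h {..<m} \<and> (\<forall>x\<in>{..<m}. h x \<in> N x)"
      by (intro hall_marriage) (auto simp: N_def not_less)
    then show False using assms by (auto simp: N_def)
  qed
  then obtain X where X: "X \<subseteq> {..<m}" "card (\<Union>x\<in>X. N x) < card X" by blast
  define U where "U = {m..<2 * m} - (\<Union>x\<in>X. N x)"
  have "card X \<le> m" using card_mono[OF _ X(1)] by simp
  have sub: "(\<Union>x\<in>X. N x) \<subseteq> {m..<2 * m}" by (auto simp: N_def)
  have "card U = m - card (\<Union>x\<in>X. N x)"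
    unfolding U_def using sub by (subst card_Diff_subset) (auto intro: finite_subset)
  then have "Suc m - card X \<le> card U" using X(2) \<open>card X \<le> m\<close> by linarith
  then obtain T where T: "T \<subseteq> U" "card T = Suc m - card X"
    using obtain_subset_with_card_n by metis
  have "\<forall>i\<in>X. \<forall>j\<in>T. f (i, j)" using T(1) by (auto simp: U_def N_def)
  moreover have "card X + card T = Suc m" using T \<open>card X \<le> m\<close> by simp
  moreover have "T \<subseteq> {m..<2 * m}" using T by (auto simp: U_def)
  ultimately show ?thesis using X(1) by blast
qed

section \<open>Product measures and counting variables\<close>

lemma prob_Pi_pmf_all_in:
  assumes "finite A" "B \<subseteq> A"
  shows "measure_pmf.prob (Pi_pmf A d p) {h. \<forall>x\<in>B. h x \<in> C x} =
    (\<Prod>x\<in>B. measure_pmf.prob (p x) (C x))"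
proof -
  define C' where "C' x = (if x \<in> B then C x else UNIV)" for x
  have "{h. \<forall>x\<in>B. h x \<in> C x} = Pi A C'"
    using assms by (auto simp: C'_def Pi_def)
  then have "measure_pmf.prob (Pi_pmf A d p) {h. \<forall>x\<in>B. h x \<in> C x} =
    (\<Prod>x\<in>A. measure_pmf.prob (p x) (C' x))"
    using measure_Pi_pmf_Pi[OF assms(1), of d p C'] by simp
  also have "\<dots> = (\<Prod>x\<in>B. measure_pmf.prob (p x) (C' x))"
    using assms by (intro prod.mono_neutral_right) (auto simp: C'_def)
  finally show ?thesis by (simp add: C'_def)
qed

lemma expectation_card_events:
  fixes M :: "'a pmf"
  assumes "finite I"
  shows "measure_pmf.expectation M (\<lambda>h. real (card {i \<in> I. h \<in> Ev i})) =
    (\<Sum>i\<in>I. measure_pmf.prob M (Ev i))"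
proof -
  have "real (card {i \<in> I. h \<in> Ev i}) = (\<Sum>i\<in>I. indicator (Ev i) h)" for h
    using assms by (simp add: indicator_def sum.If_cases Int_def)
  then show ?thesis
    by (simp, subst Bochner_Integration.integral_sum)
      (auto intro!: integrable_real_indicator simp: less_top[symmetric])
qed

lemma integrable_card_events:
  fixes M :: "'a pmf"
  assumes "finite I"
  shows "integrable M (\<lambda>h. real (card {i \<in> I. h \<in> Ev i}))"
  using assms
  by (intro measure_pmf.integrable_const_bound[where B = "real (card I)"]) (auto intro!: card_mono)

lemma markov_card_events:
  fixes M :: "'a pmf"
  assumes "finite I" "t > 0"
  shows "measure_pmf.prob M {h. t \<le> real (card {i \<in> I. h \<in> Ev i})} \<le>
    (\<Sum>i\<in>I. measure_pmf.prob M (Ev i)) / t"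
  using integral_Markov_inequality_measure[OF integrable_card_events[OF assms(1), of M Ev], of "{}" t]
    assms by (simp add: expectation_card_events)

text \<open>Second moment method: if pairs of events exceed independence by a factor of at most
  \<open>K\<close>, the variance is at most \<open>\<mu> + (K - 1) * \<mu>\<^sup>2\<close>, and
  Chebyshev's inequality is applied at distance \<open>\<mu> / 2\<close> from the mean.\<close>

lemma chebyshev_card_events:
  fixes M :: "'a pmf" and Ev :: "'i \<Rightarrow> 'a set"
  assumes "finite I"
  defines "\<mu> \<equiv> (\<Sum>i\<in>I. measure_pmf.prob M (Ev i))"
  assumes "\<mu> > 0" "K \<ge> 0"
    and corr: "\<And>i j. i \<in> I \<Longrightarrow> j \<in> I \<Longrightarrow> i \<noteq> j \<Longrightarrow>
      measure_pmf.prob M (Ev i \<inter> Ev j) \<le> K * (measure_pmf.prob M (Ev i) * measure_pmf.prob M (Ev j))"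
  shows "measure_pmf.prob M {h. real (card {i \<in> I. h \<in> Ev i}) \<le> \<mu> / 2} \<le> 4 * (1 / \<mu> + (K - 1))"
proof -
  define X where "X h = real (card {i \<in> I. h \<in> Ev i})" for h
  let ?P = "\<lambda>i. measure_pmf.prob M (Ev i)"
  have X_int: "integrable M X" unfolding X_def by (rule integrable_card_events[OF assms(1)])
  have EX: "measure_pmf.expectation M X = \<mu>"
    unfolding X_def \<mu>_def by (rule expectation_card_events[OF assms(1)])
  have X2: "(X h)\<^sup>2 = real (card {z \<in> I \<times> I. h \<in> Ev (fst z) \<inter> Ev (snd z)})" for h
  proof -
    have "{z \<in> I \<times> I. h \<in> Ev (fst z) \<inter> Ev (snd z)} = {i \<in> I. h \<in> Ev i} \<times> {i \<in> I. h \<in> Ev i}"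
      by auto
    then show ?thesis by (simp add: X_def card_cartesian_product power2_eq_square)
  qed
  have X2_int: "integrable M (\<lambda>h. (X h)\<^sup>2)"
    unfolding X2 using assms(1) by (intro integrable_card_events[where I = "I \<times> I"]) auto
  have "measure_pmf.expectation M (\<lambda>h. (X h)\<^sup>2) =
      (\<Sum>z\<in>I \<times> I. measure_pmf.prob M (Ev (fst z) \<inter> Ev (snd z)))"
    unfolding X2 using assms(1) by (subst expectation_card_events) auto
  \<comment> \<open>The diagonal is not covered by \<open>corr\<close>; its terms are bounded by
    \<open>?P (fst z)\<close>, and the extra nonnegative product makes the double sum
    factor.\<close>
  also have "\<dots> \<le> (\<Sum>z\<in>I \<times> I. (if fst z = snd z then ?P (fst z) else 0) + K * (?P (fst z) * ?P (snd z)))"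
  proof (rule sum_mono)
    fix z assume z: "z \<in> I \<times> I"
    have "0 \<le> K * (?P (fst z) * ?P (snd z))" using assms(4) by simp
    then show "measure_pmf.prob M (Ev (fst z) \<inter> Ev (snd z)) \<le>
        (if fst z = snd z then ?P (fst z) else 0) + K * (?P (fst z) * ?P (snd z))"
      using z corr[of "fst z" "snd z"] by (cases "fst z = snd z") auto
  qed
  also have "\<dots> = (\<Sum>i\<in>I. \<Sum>j\<in>I. (if i = j then ?P i else 0) + K * (?P i * ?P j))"
    by (simp add: sum.cartesian_product case_prod_unfold)
  also have "\<dots> = \<mu> + K * \<mu>\<^sup>2"
    using assms(1)
    by (simp add: sum.distrib \<mu>_def power2_eq_square sum_product flip: sum_distrib_left)
  finally have EX2: "measure_pmf.expectation M (\<lambda>h. (X h)\<^sup>2) \<le> \<mu> + K * \<mu>\<^sup>2" .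
  have "measure_pmf.variance M X \<le> \<mu> + (K - 1) * \<mu>\<^sup>2"
    using EX2 by (subst measure_pmf.variance_eq[OF X_int X2_int]) (simp add: EX algebra_simps)
  have "measure_pmf.prob M {h. X h \<le> \<mu> / 2} \<le> measure_pmf.prob M {h. \<mu> / 2 \<le> \<bar>X h - \<mu>\<bar>}"
    using \<open>\<mu> > 0\<close> by (intro measure_pmf.finite_measure_mono) (auto simp: abs_real_def)
  also have "\<dots> \<le> measure_pmf.variance M X / (\<mu> / 2)\<^sup>2"
    using measure_pmf.Chebyshev_inequality[of X M "\<mu> / 2"] X2_int \<open>\<mu> > 0\<close> by (simp add: EX)
  also have "\<dots> \<le> (\<mu> + (K - 1) * \<mu>\<^sup>2) / (\<mu> / 2)\<^sup>2"
    by (intro divide_right_mono) (fact, simp)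
  also have "\<dots> = 4 * (1 / \<mu> + (K - 1))"
    using \<open>\<mu> > 0\<close> by (simp add: field_simps power2_eq_square)
  finally show ?thesis by (simp add: X_def)
qed

section \<open>Changing the edge probability: likelihood ratios and thinning\<close>

text \<open>Let \<open>L\<close> be the likelihood ratio of the \<open>q\<close>-measure to the
  \<open>p\<close>-measure. By Cauchy-Schwarz the squared \<open>q\<close>-probability of
  \<open>S\<close> is at most its \<open>p\<close>-probability times the second moment of
  \<open>L\<close>. That moment is a product over \<open>A\<close> of factors
  \<open>1 + (p - q)\<^sup>2 / (p * (1 - p))\<close>, each bounded by an exponential.\<close>

lemma prob_Pi_bernoulli_contiguous:
  fixes p q :: real
  assumes A: "finite A" and p: "0 < p" "p < 1" and q: "0 \<le> q" "q \<le> 1"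
  shows "(measure_pmf.prob (Pi_pmf A False (\<lambda>_. bernoulli_pmf q)) S)\<^sup>2 \<le>
    exp (real (card A) * (p - q)\<^sup>2 / (p * (1 - p))) *
      measure_pmf.prob (Pi_pmf A False (\<lambda>_. bernoulli_pmf p)) S"
proof -
  let ?P = "Pi_pmf A False (\<lambda>_. bernoulli_pmf p)" and ?Q = "Pi_pmf A False (\<lambda>_. bernoulli_pmf q)"
  \<comment> \<open>Both measures live on the finite set \<open>F\<close>, which turns probabilities
    and expectations into finite sums.\<close>
  define F where "F = PiE_dflt A False (\<lambda>_. UNIV :: bool set)"
  have finF: "finite F" unfolding F_def using A by (intro finite_PiE_dflt) auto
  have F_dflt: "f x = False" if "f \<in> F" "x \<notin> A" for f x
    using that by (auto simp: F_def PiE_dflt_def)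
  have prob_sum: "measure_pmf.prob (Pi_pmf A False (\<lambda>_. bernoulli_pmf u)) S =
      (\<Sum>f\<in>S \<inter> F. pmf (Pi_pmf A False (\<lambda>_. bernoulli_pmf u)) f)" for u S
  proof -
    have "measure_pmf.prob (Pi_pmf A False (\<lambda>_. bernoulli_pmf u)) S =
        measure_pmf.prob (Pi_pmf A False (\<lambda>_. bernoulli_pmf u)) (S \<inter> F)"
      using A by (intro measure_prob_cong_0) (auto simp: F_def PiE_dflt_def intro!: pmf_Pi_outside)
    then show ?thesis using finF by (simp add: measure_measure_pmf_finite)
  qed
  define l where "l b = (if b then q / p else (1 - q) / (1 - p))" for b
  define L where "L f = (\<Prod>x\<in>A. l (f x))" for f :: "'a \<Rightarrow> bool"
  have l_nonneg: "0 \<le> l b" for b using p q by (simp add: l_def)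
  have l_pmf: "pmf (bernoulli_pmf q) b = pmf (bernoulli_pmf p) b * l b" for b
    using p q by (cases b) (auto simp: l_def)
  have L_pmf: "pmf ?Q f = pmf ?P f * L f" if "f \<in> F" for f
    using A F_dflt[OF that] by (simp add: pmf_Pi L_def l_pmf prod.distrib)
  have "measure_pmf.expectation ?P (\<lambda>f. \<Prod>x\<in>A. (l (f x))\<^sup>2) =
      (\<Prod>x\<in>A. measure_pmf.expectation (bernoulli_pmf p) (\<lambda>b. (l b)\<^sup>2))"
    using A by (intro expectation_prod_Pi_pmf integrable_measure_pmf_finite) auto
  also have "measure_pmf.expectation (bernoulli_pmf p) (\<lambda>b. (l b)\<^sup>2) = 1 + (p - q)\<^sup>2 / (p * (1 - p))"
  proof -
    define w where "w = 1 - p"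
    have w: "w > 0" using p by (simp add: w_def)
    have "measure_pmf.expectation (bernoulli_pmf p) (\<lambda>b. (l b)\<^sup>2) = p * (q / p)\<^sup>2 + w * ((1 - q) / w)\<^sup>2"
      using p by (simp add: l_def w_def mult.commute)
    also have "\<dots> = (q\<^sup>2 * w + (1 - q)\<^sup>2 * p) / (p * w)"
      using p w by (simp add: field_simps power2_eq_square)
    also have "q\<^sup>2 * w + (1 - q)\<^sup>2 * p = p * w + (p - q)\<^sup>2"
      unfolding w_def by algebra
    also have "(p * w + (p - q)\<^sup>2) / (p * w) = 1 + (p - q)\<^sup>2 / (p * w)"
      using p w by (simp add: add_divide_distrib)
    finally show ?thesis by (simp add: w_def)
  qed
  also have "(\<Prod>x\<in>A. 1 + (p - q)\<^sup>2 / (p * (1 - p))) \<le> exp ((p - q)\<^sup>2 / (p * (1 - p))) ^ card A"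
    using p by (simp, intro power_mono) auto
  also have "\<dots> = exp (real (card A) * (p - q)\<^sup>2 / (p * (1 - p)))"
    by (simp add: exp_of_nat_mult[symmetric])
  finally have "measure_pmf.expectation ?P (\<lambda>f. \<Prod>x\<in>A. (l (f x))\<^sup>2) \<le>
      exp (real (card A) * (p - q)\<^sup>2 / (p * (1 - p)))" .
  moreover have "measure_pmf.expectation ?P (\<lambda>f. \<Prod>x\<in>A. (l (f x))\<^sup>2) = (\<Sum>f\<in>F. pmf ?P f * (L f)\<^sup>2)"
  proof -
    have "f \<in> F" if "f \<in> set_pmf ?P" for f
      using set_Pi_pmf_subset'[OF A, of False "\<lambda>_. bernoulli_pmf p"] that
      by (auto simp: F_def PiE_dflt_def)
    then have "measure_pmf.expectation ?P (\<lambda>f. \<Prod>x\<in>A. (l (f x))\<^sup>2) =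
        (\<Sum>f\<in>F. (\<Prod>x\<in>A. (l (f x))\<^sup>2) * pmf ?P f)"
      using finF by (intro integral_measure_pmf_real) auto
    then show ?thesis by (simp add: L_def prod_power_distrib mult.commute)
  qed
  ultimately have EL2: "(\<Sum>f\<in>F. pmf ?P f * (L f)\<^sup>2) \<le> exp (real (card A) * (p - q)\<^sup>2 / (p * (1 - p)))"
    by simp
  \<comment> \<open>The weight is split into two square roots to fit the Cauchy-Schwarz inequality
    for plain sums.\<close>
  have "(measure_pmf.prob ?Q S)\<^sup>2 = (\<Sum>f\<in>S \<inter> F. sqrt (pmf ?P f) * (sqrt (pmf ?P f) * L f))\<^sup>2"
    by (simp add: prob_sum L_pmf mult.assoc[symmetric])
  also have "\<dots> \<le> (\<Sum>f\<in>S \<inter> F. (sqrt (pmf ?P f))\<^sup>2) * (\<Sum>f\<in>S \<inter> F. (sqrt (pmf ?P f) * L f)\<^sup>2)"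
    by (rule Cauchy_Schwarz_ineq_sum)
  also have "\<dots> = measure_pmf.prob ?P S * (\<Sum>f\<in>S \<inter> F. pmf ?P f * (L f)\<^sup>2)"
    by (simp add: prob_sum power_mult_distrib)
  also have "\<dots> \<le> measure_pmf.prob ?P S * (\<Sum>f\<in>F. pmf ?P f * (L f)\<^sup>2)"
    using finF by (intro mult_left_mono sum_mono2) auto
  also have "\<dots> \<le> measure_pmf.prob ?P S * exp (real (card A) * (p - q)\<^sup>2 / (p * (1 - p)))"
    using EL2 by (intro mult_left_mono) auto
  finally show ?thesis by (simp add: mult.commute)
qed

text \<open>Keeping an edge of the \<open>p\<close>-graph with probability \<open>r\<close> produces
  an edge with probability \<open>p * r\<close>; this identifies the law of the thinned
  graph.\<close>

lemma map_conj_bernoulli_pmf: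
  assumes "0 \<le> p" "p \<le> 1" "0 \<le> r" "r \<le> 1"
  shows "map_pmf (\<lambda>(a, b). a \<and> b) (pair_pmf (bernoulli_pmf p) (bernoulli_pmf r)) = bernoulli_pmf (p * r)"
proof (rule pmf_eqI)
  have True_eq: "pmf (map_pmf (\<lambda>(a, b). a \<and> b) (pair_pmf (bernoulli_pmf p) (bernoulli_pmf r))) True = p * r"
  proof -
    have "(\<lambda>(a, b). a \<and> b) -` {True} = {(True, True)}" by auto
    then show ?thesis using assms
      by (simp add: pmf_map measure_pmf_single pmf_pair)
  qed
  fix b
  show "pmf (map_pmf (\<lambda>(a, b). a \<and> b) (pair_pmf (bernoulli_pmf p) (bernoulli_pmf r))) b = pmf (bernoulli_pmf (p * r)) b"
  proof (cases b)
    case True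
    then show ?thesis using True_eq assms by (simp add: mult_le_one)
  next
    case False
    then show ?thesis using True_eq assms by (simp add: mult_le_one pmf_False_conv_True)
  qed
qed

section \<open>Concentration above the logarithm\<close>

text \<open>The left side is in fact at most \<open>x ^ s\<close>. Since
  \<open>t = m + 1 - s\<close>, the second binomial is \<open>m choose (s - 1)\<close>, so both are
  at most \<open>m ^ s\<close>; and \<open>t \<ge> m / 2\<close> bounds \<open>p ^ t\<close> by the
  exponential.\<close>

lemma binomial_product_power_le:
  fixes p :: real
  assumes st: "s + t = Suc m" "1 \<le> s" "s \<le> t" and p: "0 \<le> p" "p \<le> 1"
    and x: "x = real m ^ 2 * exp (- (1 - p) * m / 2)" "x \<le> 1"
  shows "real (m choose s) * real (m choose t) * p ^ (s * t) \<le> x"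
proof -
  have m: "m \<ge> 1" using st by auto
  have "real (m choose s) \<le> real m ^ s"
    using binomial_le_pow[of s m] st by (simp flip: of_nat_power)
  moreover have "real (m choose t) \<le> real m ^ s"
  proof -
    have "m choose t = m choose (s - 1)"
      using st by (subst binomial_symmetric) (auto intro: arg_cong2[where f = binomial])
    also have "\<dots> \<le> m ^ (s - 1)" using st by (intro binomial_le_pow) auto
    also have "\<dots> \<le> m ^ s" using m by (intro power_increasing) auto
    finally show ?thesis by (metis of_nat_le_iff of_nat_power)
  qed
  moreover have "p ^ (s * t) \<le> exp (- (1 - p) * m / 2) ^ s"
  proof -
    have "p \<le> exp (- (1 - p))" using exp_ge_add_one_self[of "- (1 - p)"] by simp
    then have "p ^ t \<le> exp (- (1 - p)) ^ t" using p by (intro power_mono) auto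
    also have "\<dots> = exp (real t * (- (1 - p)))" by (rule exp_of_nat_mult[symmetric])
    also have "\<dots> \<le> exp (- (1 - p) * m / 2)"
    proof -
      have "real m / 2 \<le> real t" using st by linarith
      then have "(1 - p) * (real m / 2) \<le> (1 - p) * real t" using p by (intro mult_left_mono) auto
      then show ?thesis by (simp add: field_simps)
    qed
    finally have "(p ^ t) ^ s \<le> exp (- (1 - p) * m / 2) ^ s" using p by (intro power_mono) auto
    then show ?thesis by (simp add: power_mult[symmetric] mult.commute)
  qed
  ultimately have "real (m choose s) * real (m choose t) * p ^ (s * t) \<le>
      real m ^ s * real m ^ s * exp (- (1 - p) * m / 2) ^ s"
    using p by (intro mult_mono) auto
  also have "\<dots> = x ^ s" by (simp add: x power_mult_distrib power2_eq_square)
  also have "\<dots> \<le> x ^ 1" using x st by (intro power_decreasing) auto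
  finally show ?thesis by simp
qed

text \<open>Union bound over completely joined pairs of sets with sizes \<open>s\<close> and
  \<open>m + 1 - s\<close>. Each of the \<open>m\<close> values of \<open>s\<close> contributes at
  most \<open>m ^ 2 * exp (- (1 - p) * m / 2)\<close>.\<close>

lemma prob_chromatic_number_gt:
  fixes p :: real
  assumes p: "0 \<le> p" "p \<le> 1" and m: "2 * m \<le> n" and x: "real m ^ 2 * exp (- (1 - p) * m / 2) \<le> 1"
  shows "measure_pmf.prob (gnp n p) {E. \<not> chromatic_number n E \<le> n - m} \<le>
    real m ^ 3 * exp (- (1 - p) * m / 2)"
proof -
  define x where "x = real m ^ 2 * exp (- (1 - p) * m / 2)"
  define Q where "Q s = {S. S \<subseteq> {..<m} \<and> card S = s} \<times> {T. T \<subseteq> {m..<2 * m} \<and> card T = Suc m - s}" for s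
  define F where "F z = {f. \<forall>e \<in> fst z \<times> snd z. f e \<in> {True}}" for z :: "nat set \<times> nat set"
  let ?M = "Pi_pmf (vpairs n) False (\<lambda>_. bernoulli_pmf p)"
  have finQ: "finite (Q s)" for s unfolding Q_def by auto
  have cardQ: "card (Q s) = (m choose s) * (m choose (Suc m - s))" for s
    using n_subsets[of "{..<m}" s] n_subsets[of "{m..<2 * m}" "Suc m - s"]
    by (simp add: Q_def card_cartesian_product)
  have probF: "measure_pmf.prob ?M (F z) = p ^ (s * (Suc m - s))" if "z \<in> Q s" for z s
  proof -
    have "fst z \<times> snd z \<subseteq> vpairs n" using that m by (force simp: Q_def vpairs_def)
    then show ?thesis
      using that p unfolding F_def
      by (subst prob_Pi_pmf_all_in) (auto simp: Q_def measure_pmf_single card_cartesian_product)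
  qed
  have "measure_pmf.prob (gnp n p) {E. \<not> chromatic_number n E \<le> n - m} =
      measure_pmf.prob ?M {f. \<not> chromatic_number n (edges_of n f) \<le> n - m}"
    by (simp add: gnp_eq_map_edges_of vimage_def)
  also have "\<dots> \<le> measure_pmf.prob ?M (\<Union>s\<in>{1..m}. \<Union>z\<in>Q s. F z)"
  proof (intro measure_pmf.finite_measure_mono subsetI)
    fix f assume "f \<in> {f. \<not> chromatic_number n (edges_of n f) \<le> n - m}"
    then have "\<not> (\<exists>h. inj_on h {..<m} \<and> (\<forall>i<m. h i \<in> {m..<2 * m} \<and> \<not> f (i, h i)))"
      using chromatic_number_le_bipartite[OF m] by blast
    then obtain S T where ST: "S \<subseteq> {..<m}" "T \<subseteq> {m..<2 * m}" "card S + card T = Suc m"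
      "\<forall>i\<in>S. \<forall>j\<in>T. f (i, j)" using complete_pair_of_no_matching by metis
    \<comment> \<open>The sizes add up to \<open>m + 1\<close> and neither exceeds \<open>m\<close>,
      so both sets are nonempty.\<close>
    have "card S \<le> m" "card T \<le> m" using ST card_mono[of "{..<m}" S] card_mono[of "{m..<2 * m}" T] by auto
    then have "card S \<in> {1..m}" "(S, T) \<in> Q (card S)" using ST by (auto simp: Q_def)
    moreover have "f \<in> F (S, T)" using ST by (auto simp: F_def)
    ultimately show "f \<in> (\<Union>s\<in>{1..m}. \<Union>z\<in>Q s. F z)" by blast
  qed simp
  also have "\<dots> \<le> (\<Sum>s\<in>{1..m}. measure_pmf.prob ?M (\<Union>z\<in>Q s. F z))"
    by (rule measure_UNION_le) auto
  also have "\<dots> \<le> (\<Sum>s\<in>{1..m}. x)"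
  proof (rule sum_mono)
    fix s assume s: "s \<in> {1..m}"
    have "measure_pmf.prob ?M (\<Union>z\<in>Q s. F z) \<le> (\<Sum>z\<in>Q s. measure_pmf.prob ?M (F z))"
      by (rule measure_UNION_le) (auto simp: finQ)
    also have "\<dots> = real (m choose s) * real (m choose (Suc m - s)) * p ^ (s * (Suc m - s))"
      by (simp add: probF cardQ)
    also have "\<dots> \<le> x"
    proof (cases "s \<le> Suc m - s")
      case True
      then show ?thesis using s p x
        by (intro binomial_product_power_le[where m = m]) (auto simp: x_def)
    next
      case False
      then have "real (m choose (Suc m - s)) * real (m choose s) * p ^ ((Suc m - s) * s) \<le> x"
        using s p x by (intro binomial_product_power_le[where m = m]) (auto simp: x_def)
      then show ?thesis by (simp add: mult_ac)
    qed
    finally show "measure_pmf.prob ?M (\<Union>z\<in>Q s. F z) \<le> x" .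
  qed
  also have "\<dots> = real m ^ 3 * exp (- (1 - p) * m / 2)"
    by (simp add: x_def power2_eq_square power3_eq_cube)
  finally show ?thesis .
qed

text \<open>Markov's inequality: there are at most \<open>n ^ 3\<close> triples, each independent
  with probability \<open>(1 - p) ^ 3\<close>.\<close>

lemma prob_indep_triples_ge:
  fixes p t :: real
  assumes p: "0 \<le> p" "p \<le> 1" and t: "t > 0"
  shows "measure_pmf.prob (gnp n p) {E. t \<le> real (card (indep_triples n E))} \<le> (real n * (1 - p)) ^ 3 / t"
proof -
  let ?M = "Pi_pmf (vpairs n) False (\<lambda>_. bernoulli_pmf p)"
  define I where "I = {(a, b, v). a < b \<and> b < v \<and> v < n}"
  define B where "B = (\<lambda>(a, b, v). {(a, b), (a, v), (b, v :: nat)} :: (nat \<times> nat) set)"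
  define Ev where "Ev z = {f. \<forall>e\<in>B z. f e \<in> {False}}" for z
  have I: "I \<subseteq> {..<n} \<times> {..<n} \<times> {..<n}" by (auto simp: I_def)
  then have "card I \<le> card ({..<n} \<times> {..<n} \<times> {..<n})" by (intro card_mono) auto
  then have cardI: "card I \<le> n ^ 3" by (simp add: card_cartesian_product power3_eq_cube)
  have finI: "finite I" using I finite_subset by blast
  have trip: "indep_triples n (edges_of n f) = {z \<in> I. f \<in> Ev z}" for f
    by (auto simp: indep_triples_def I_def Ev_def B_def edge_iff)
  have prob: "measure_pmf.prob ?M (Ev z) = (1 - p) ^ 3" if z: "z \<in> I" for z
  proof -
    obtain a b v where z': "z = (a, b, v)" "a < b" "b < v" "v < n" using z by (auto simp: I_def)
    have "B z \<subseteq> vpairs n" using z' by (auto simp: B_def vpairs_def)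
    moreover have "card (B z) = 3" using z' by (auto simp: B_def)
    ultimately show ?thesis unfolding Ev_def
      using p by (subst prob_Pi_pmf_all_in) (auto simp: measure_pmf_single)
  qed
  have "measure_pmf.prob (gnp n p) {E. t \<le> real (card (indep_triples n E))} =
      measure_pmf.prob ?M {f. t \<le> real (card {z \<in> I. f \<in> Ev z})}"
    by (simp add: gnp_eq_map_edges_of vimage_def trip)
  also have "\<dots> \<le> (\<Sum>z\<in>I. measure_pmf.prob ?M (Ev z)) / t"
    by (rule markov_card_events[OF finI t])
  also have "\<dots> = real (card I) * (1 - p) ^ 3 / t" by (simp add: prob)
  also have "\<dots> \<le> real (n ^ 3) * (1 - p) ^ 3 / t"
    using cardI p t by (intro divide_right_mono mult_right_mono) (auto simp del: of_nat_power)
  finally show ?thesis by (simp add: power_mult_distrib)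
qed

lemma chromatic_number_complete:
  assumes "\<And>i j. i < j \<Longrightarrow> j < n \<Longrightarrow> f (i, j)"
  shows "chromatic_number n (edges_of n f) = n"
proof (rule antisym)
  show "chromatic_number n (edges_of n f) \<le> n"
    using chromatic_number_le_card_image[of n "edges_of n f" id] by simp
  obtain c where c: "proper_colouring n (edges_of n f) (chromatic_number n (edges_of n f)) c"
    using chromatic_number_attained by blast
  have "inj_on c {..<n}"
  proof (rule linorder_inj_onI)
    fix u v assume "u < v" "u \<in> {..<n}" "v \<in> {..<n}"
    moreover from this have "{u, v} \<in> edges_of n f" using assms by (simp add: edge_iff)
    ultimately show "c u \<noteq> c v" using c by (auto simp: proper_colouring_def)
  qed auto
  moreover have "c ` {..<n} \<subseteq> {..<chromatic_number n (edges_of n f)}"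
    using c by (auto simp: proper_colouring_def)
  ultimately have "card {..<n} \<le> card {..<chromatic_number n (edges_of n f)}"
    by (intro card_inj_on_le) auto
  then show "n \<le> chromatic_number n (edges_of n f)" by simp
qed

text \<open>A matching of size \<open>n div 2\<close> in the complement gives the upper end. If the
  lower end fails, then twice the chromatic number is below \<open>n + 1 - 2 * k\<close>, which
  forces more than \<open>2 * k - 1\<close> independent triples.\<close>

lemma prob_chromatic_number_outside:
  fixes p k :: real
  assumes p: "0 \<le> p" "p \<le> 1" and n: "n \<ge> 2" and dense: "24 * ln (real n) \<le> real n * (1 - p)"
    and k: "2 * k > 1"
  shows "measure_pmf.prob (gnp n p) {E. real (chromatic_number n E) \<notin> {(real n + 1) / 2 - k .. (real n + 1) / 2}}
    \<le> 1 / real n + (real n * (1 - p)) ^ 3 / (2 * k - 1)"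
proof -
  define m where "m = n div 2"
  have "n \<le> 3 * m" "n \<le> 2 * m + 1" using n unfolding m_def by presburger+
  then have m: "2 * m \<le> n" "real n / 3 \<le> real m" "real m \<le> real n" "real n - 1 \<le> 2 * real m"
    unfolding m_def by linarith+
  \<comment> \<open>The constant 24 is chosen here: with \<open>m \<ge> n / 3\<close> the exponent
    is at most \<open>- 24 * ln n / 6 = - 4 * ln n\<close>.\<close>
  have "(1 - p) * (real n / 3) \<le> (1 - p) * real m" using p m by (intro mult_left_mono) auto
  then have "- (1 - p) * real m / 2 \<le> - (real n * (1 - p)) / 6" by (simp add: field_simps)
  also have "\<dots> \<le> - (4 * ln (real n))" using dense by simp
  finally have "exp (- (1 - p) * real m / 2) \<le> exp (- (4 * ln (real n)))" by simp
  also have "\<dots> = 1 / real n ^ 4"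
    using n by (simp add: exp_minus exp_of_nat_mult[of 4, simplified] inverse_eq_divide)
  finally have e: "exp (- (1 - p) * real m / 2) \<le> 1 / real n ^ 4" .
  \<comment> \<open>Used with \<open>j = 2\<close> for the side condition of the union bound and
    with \<open>j = 3\<close> for its result \<open>1 / n\<close>.\<close>
  have le: "real m ^ j * exp (- (1 - p) * real m / 2) \<le> 1 / real n ^ (4 - j)" if "j \<le> 4" for j
  proof -
    have "real m ^ j * exp (- (1 - p) * real m / 2) \<le> real n ^ j * (1 / real n ^ 4)"
      using m e by (intro mult_mono power_mono) auto
    also have "\<dots> = 1 / real n ^ (4 - j)"
      using n that by (simp add: power_diff)
    finally show ?thesis .
  qed
  have "1 / real n ^ 2 \<le> 1" using n by simp
  then have x: "real m ^ 2 * exp (- (1 - p) * real m / 2) \<le> 1" using le[of 2] by simp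
  have "{E. real (chromatic_number n E) \<notin> {(real n + 1) / 2 - k .. (real n + 1) / 2}} \<subseteq>
      {E. \<not> chromatic_number n E \<le> n - m} \<union> {E. 2 * k - 1 \<le> real (card (indep_triples n E))}"
  proof
    fix E assume E: "E \<in> {E. real (chromatic_number n E) \<notin> {(real n + 1) / 2 - k .. (real n + 1) / 2}}"
    show "E \<in> {E. \<not> chromatic_number n E \<le> n - m} \<union> {E. 2 * k - 1 \<le> real (card (indep_triples n E))}"
    proof (rule ccontr)
      assume "\<not> ?thesis"
      then have *: "chromatic_number n E \<le> n - m" "real (card (indep_triples n E)) < 2 * k - 1" by auto
      have "real n \<le> 2 * real (chromatic_number n E) + real (card (indep_triples n E))"
        using order_le_twice_chromatic_number[of n E] by linarith
      moreover have "real (chromatic_number n E) \<le> real n - real m" using *(1) m(1) by linarith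
      ultimately show False using E *(2) m(4) by (auto simp: field_simps)
    qed
  qed
  then have "measure_pmf.prob (gnp n p) {E. real (chromatic_number n E) \<notin> {(real n + 1) / 2 - k .. (real n + 1) / 2}}
    \<le> measure_pmf.prob (gnp n p)
      ({E. \<not> chromatic_number n E \<le> n - m} \<union> {E. 2 * k - 1 \<le> real (card (indep_triples n E))})"
    by (intro measure_pmf.finite_measure_mono) auto
  also have "\<dots> \<le> measure_pmf.prob (gnp n p) {E. \<not> chromatic_number n E \<le> n - m} +
      measure_pmf.prob (gnp n p) {E. 2 * k - 1 \<le> real (card (indep_triples n E))}"
    by (rule measure_Un_le) auto
  also have "\<dots> \<le> 1 / real n + (real n * (1 - p)) ^ 3 / (2 * k - 1)"
    using prob_chromatic_number_gt[OF p m(1) x] le[of 3] prob_indep_triples_ge[OF p, of "2 * k - 1" n] k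
    by simp
  finally show ?thesis .
qed

lemma prob_compl_Collect:
  "measure_pmf.prob M {x. \<not> P x} = 1 - measure_pmf.prob M {x. P x}"
  using measure_pmf.prob_compl[of "{x. P x}" M] by (simp add: Compl_eq_Diff_UNIV[symmetric] Collect_neg_eq)

text \<open>Apart from the degenerate case, the interval ends at \<open>(n + 1) / 2\<close>. The
  failure probability is at most \<open>1 / n\<close> plus the cube of \<open>n * (1 - p n)\<close>
  over \<open>2 * k n - 1\<close>, and the cube is eventually at most
  \<open>n powr (\<epsilon> / 2)\<close>.\<close>

lemma chromatic_number_concentrated:
  fixes \<epsilon> :: real and p :: "nat \<Rightarrow> real"
  assumes eps: "\<epsilon> > 0" and p: "\<And>n. 0 \<le> p n \<and> p n \<le> 1"
    and lower: "(\<lambda>n. ln (real n) / (real n * (1 - p n))) \<longlonglongrightarrow> 0"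
    and \<eta>: "\<eta> \<longlonglongrightarrow> 0" and upper: "\<forall>\<^sub>F n in sequentially. real n * (1 - p n) \<le> real n powr (\<eta> n)"
  shows "\<exists>a. (\<lambda>n. measure_pmf.prob (gnp n (p n))
    {E. real (chromatic_number n E) \<in> {a n .. a n + real_of_int \<lfloor>real n powr \<epsilon>\<rfloor>}}) \<longlonglongrightarrow> 1"
proof -
  define k where "k n = real_of_int \<lfloor>real n powr \<epsilon>\<rfloor>" for n
  \<comment> \<open>Since \<open>x / 0 = 0\<close>, the hypotheses admit \<open>p n = 1\<close>, where the graph is complete.\<close>
  define a where "a n = (if p n = 1 then real n else (real n + 1) / 2 - k n)" for n
  define g where "g n = measure_pmf.prob (gnp n (p n))
    {E. real (chromatic_number n E) \<in> {a n .. a n + k n}}" for n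
  have lo: "\<forall>\<^sub>F n in sequentially. 1 - (1 / real n + real n powr (- \<epsilon> / 2)) \<le> g n"
  proof -
    have "\<forall>\<^sub>F n in sequentially. \<bar>ln (real n) / (real n * (1 - p n))\<bar> < 1 / 24"
      using tendstoD[OF lower, of "1 / 24"] by (simp add: dist_real_def)
    moreover have "\<forall>\<^sub>F n in sequentially. \<eta> n < \<epsilon> / 6"
      using order_tendstoD(2)[OF \<eta>, of "\<epsilon> / 6"] eps by simp
    \<comment> \<open>The bound 3 absorbs the rounding in \<open>k n\<close> and yields
      \<open>2 * k n - 1 \<ge> n powr \<epsilon>\<close>.\<close>
    moreover have "\<forall>\<^sub>F n in sequentially. 3 \<le> real n powr \<epsilon>"
      using eps by real_asymp
    moreover have "\<forall>\<^sub>F n in sequentially. n \<ge> (2 :: nat)" by (rule eventually_ge_at_top)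
    ultimately show ?thesis using upper
    proof eventually_elim
      case (elim n)
      have k: "real n powr \<epsilon> - 1 < k n" unfolding k_def by linarith
      show ?case
      proof (cases "p n = 1")
        case True
        let ?M = "Pi_pmf (vpairs n) False (\<lambda>_. bernoulli_pmf 1)"
        have "1 = measure_pmf.prob ?M {f. \<forall>e\<in>vpairs n. f e \<in> {True}}"
          by (subst prob_Pi_pmf_all_in) (auto simp: measure_pmf_single)
        also have "\<dots> \<le> measure_pmf.prob ?M
            {f. real (chromatic_number n (edges_of n f)) \<in> {real n .. real n + k n}}"
          using k elim(3)
          by (intro measure_pmf.finite_measure_mono) (auto simp: chromatic_number_complete vpairs_def)
        also have "\<dots> = g n"
          unfolding g_def a_def gnp_eq_map_edges_of True by (simp add: vimage_def)
        finally show ?thesis using elim(4) by (smt (verit) divide_nonneg_nonneg of_nat_0_le_iff powr_ge_zero)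
      next
        case False
        have q: "0 < 1 - p n" using p[of n] False by simp
        have pos: "0 < real n * (1 - p n)" using q elim(4) by simp
        have "24 * ln (real n) \<le> real n * (1 - p n)"
          using elim(1) pos by (simp add: field_simps abs_less_iff)
        moreover have k2: "real n powr \<epsilon> \<le> 2 * k n - 1" using k elim(3) by linarith
        moreover have "1 - g n = measure_pmf.prob (gnp n (p n))
            {E. real (chromatic_number n E) \<notin> {(real n + 1) / 2 - k n .. (real n + 1) / 2}}"
          using False by (simp only: g_def a_def prob_compl_Collect if_False diff_add_cancel)
        ultimately have "1 - g n \<le> 1 / real n + (real n * (1 - p n)) ^ 3 / (2 * k n - 1)"
          using prob_chromatic_number_outside[of "p n" n "k n"] p[of n] elim(3,4) by linarith
        also have "(real n * (1 - p n)) ^ 3 / (2 * k n - 1) \<le> real n powr (\<epsilon> / 2) / real n powr \<epsilon>"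
        proof (rule frac_le)
          have "real n * (1 - p n) \<le> real n powr (\<epsilon> / 6)"
            using elim(5,2,4) by (elim order_trans) (auto intro!: powr_mono)
          then have "(real n * (1 - p n)) ^ 3 \<le> (real n powr (\<epsilon> / 6)) ^ 3"
            using pos by (intro power_mono) auto
          also have "\<dots> = real n powr (\<epsilon> / 2)"
            using elim(4) by (simp add: powr_power)
          finally show "(real n * (1 - p n)) ^ 3 \<le> real n powr (\<epsilon> / 2)" .
        qed (use k2 elim(4) in auto)
        also have "\<dots> = real n powr (- \<epsilon> / 2)"
          by (simp add: powr_diff[symmetric])
        finally show ?thesis by simp
      qed
    qed
  qed
  have lim: "(\<lambda>n. 1 - (1 / real n + real n powr (- \<epsilon> / 2))) \<longlonglongrightarrow> 1"
  proof -
    have "(\<lambda>n. real n powr (- \<epsilon> / 2)) \<longlonglongrightarrow> 0"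
      using eps by (intro tendsto_neg_powr filterlim_real_sequentially) auto
    moreover have "(\<lambda>n. 1 / real n) \<longlonglongrightarrow> 0" by real_asymp
    ultimately have "(\<lambda>n. 1 - (1 / real n + real n powr (- \<epsilon> / 2))) \<longlonglongrightarrow> 1 - (0 + 0)"
      by (intro tendsto_intros)
    then show ?thesis by simp
  qed
  have "g \<longlonglongrightarrow> 1"
    by (rule tendsto_sandwich[OF lo _ lim tendsto_const]) (simp add: g_def)
  then show ?thesis unfolding g_def k_def by blast
qed

section \<open>Fluctuations below the logarithm\<close>

definition touching :: "nat \<Rightarrow> nat \<times> nat \<Rightarrow> (nat \<times> nat) set" where
  "touching n e = {x \<in> vpairs n. x \<noteq> e \<and> {fst x, snd x} \<inter> {fst e, snd e} \<noteq> {}}"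

definition ordered :: "nat \<times> nat \<Rightarrow> nat \<times> nat" where
  "ordered z = (min (fst z) (snd z), max (fst z) (snd z))"

lemma finite_touching [simp]: "finite (touching n e)"
  by (rule finite_subset[OF _ finite_vpairs[of n]]) (auto simp: touching_def)

lemma card_touching_le: "card (touching n e) \<le> 2 * n"
proof -
  have "touching n e \<subseteq> ordered ` ({fst e, snd e} \<times> {..<n})"
  proof
    fix x assume "x \<in> touching n e"
    then have x: "fst x < snd x" "snd x < n" "{fst x, snd x} \<inter> {fst e, snd e} \<noteq> {}"
      by (auto simp: touching_def vpairs_def)
    then have "x = ordered (fst x, snd x)" "x = ordered (snd x, fst x)" by (auto simp: ordered_def)
    moreover have "(fst x, snd x) \<in> {fst e, snd e} \<times> {..<n} \<or> (snd x, fst x) \<in> {fst e, snd e} \<times> {..<n}"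
      using x(3) x(2) order_less_trans[OF x(1,2)] by blast
    ultimately show "x \<in> ordered ` ({fst e, snd e} \<times> {..<n})" by (metis image_eqI)
  qed
  then have "card (touching n e) \<le> card ({fst e, snd e} \<times> {..<n})"
    by (rule surj_card_le[rotated]) auto
  also have "\<dots> \<le> 2 * n" by (simp add: card_cartesian_product card_insert_if)
  finally show ?thesis .
qed

text \<open>A pair meeting both \<open>e\<close> and \<open>e'\<close> joins an end of one to an end
  of the other. These at most four pairs are the only source of dependence between the fresh-edge
  events of vertex-disjoint pairs.\<close>

lemma card_touching_Int_le:
  assumes "{fst e, snd e} \<inter> {fst e', snd e'} = {}"
  shows "card (touching n e \<inter> touching n e') \<le> 4"
proof -
  have "touching n e \<inter> touching n e' \<subseteq> ordered ` ({fst e, snd e} \<times> {fst e', snd e'})"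
  proof
    fix x assume "x \<in> touching n e \<inter> touching n e'"
    then have x: "fst x < snd x" "{fst x, snd x} \<inter> {fst e, snd e} \<noteq> {}" 
      "{fst x, snd x} \<inter> {fst e', snd e'} \<noteq> {}"
      by (auto simp: touching_def vpairs_def)
    then have eq: "x = ordered (fst x, snd x)" "x = ordered (snd x, fst x)" by (auto simp: ordered_def)
    have "(fst x, snd x) \<in> {fst e, snd e} \<times> {fst e', snd e'} \<or>
          (snd x, fst x) \<in> {fst e, snd e} \<times> {fst e', snd e'}"
      using x(2,3) assms by blast
    with eq show "x \<in> ordered ` ({fst e, snd e} \<times> {fst e', snd e'})" by (metis image_eqI)
  qed
  then have "card (touching n e \<inter> touching n e') \<le> card ({fst e, snd e} \<times> {fst e', snd e'})"
    by (rule surj_card_le[rotated]) auto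
  also have "\<dots> \<le> 2 * 2"
    unfolding card_cartesian_product by (intro mult_le_mono) (auto simp: card_insert_if)
  finally show ?thesis by simp
qed

text \<open>A configuration assigns to every pair of vertices a pair of bits: whether it is an edge of the
  graph, and whether it is retained in the thinned subgraph. The event below says that \<open>e\<close> is an
  edge that is not retained, while all other pairs meeting \<open>e\<close> are retained edges; in the complements,
  \<open>e\<close> joins two isolated vertices and becomes an isolated edge.\<close>

definition fresh_edge :: "nat \<Rightarrow> nat \<times> nat \<Rightarrow> (nat \<times> nat \<Rightarrow> bool \<times> bool) set" where
  "fresh_edge n e = {h. h e = (True, False) \<and> (\<forall>x\<in>touching n e. h x = (True, True))}"

text \<open>With a common endpoint, \<open>e'\<close> would have to be retained because of
  \<open>e\<close> and not retained on its own account.\<close>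

lemma fresh_edges_disjoint:
  assumes "h \<in> fresh_edge n e" "h \<in> fresh_edge n e'" "e' \<in> vpairs n" "e \<noteq> e'"
  shows "{fst e, snd e} \<inter> {fst e', snd e'} = {}"
proof (rule ccontr)
  assume "\<not> ?thesis"
  then have "e' \<in> touching n e" using assms by (auto simp: touching_def)
  then show False using assms(1,2) by (auto simp: fresh_edge_def)
qed

text \<open>In the full graph both ends of a fresh edge are adjacent to all other vertices, hence
  alone in their colour classes. In the thinned graph the edge is gone, so its ends may share a
  colour; fresh edges are vertex-disjoint, so all these merges are possible at once.\<close>

lemma chromatic_number_fresh_edges:
  fixes h :: "nat \<times> nat \<Rightarrow> bool \<times> bool"
  shows "chromatic_number n (edges_of n ((\<lambda>(a, b). a \<and> b) \<circ> h)) +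
      card {e \<in> vpairs n. h \<in> fresh_edge n e} \<le> chromatic_number n (edges_of n (fst \<circ> h))"
proof -
  define M where "M = {e \<in> vpairs n. h \<in> fresh_edge n e}"
  obtain c where c: "proper_colouring n (edges_of n (fst \<circ> h)) (chromatic_number n (edges_of n (fst \<circ> h))) c"
    using chromatic_number_attained by blast
  have proper: "c u \<noteq> c v" if "u < n" "v < n" "u \<noteq> v" "{u, v} \<in> edges_of n (fst \<circ> h)" for u v
    using c that unfolding proper_colouring_def by blast
  have M: "fst e < snd e" "snd e < n" "h e = (True, False)" if "e \<in> M" for e
    using that by (auto simp: M_def vpairs_def fresh_edge_def)
  have disj: "{fst e, snd e} \<inter> {fst e', snd e'} = {}" if "e \<in> M" "e' \<in> M" "e \<noteq> e'" for e e'
    using that fresh_edges_disjoint[of h n e e'] by (auto simp: M_def)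
  have edge: "{u, v} \<in> edges_of n (fst \<circ> h)"
    if e: "e \<in> M" "u \<in> {fst e, snd e}" and "v < n" "u \<noteq> v" for e u v
  proof -
    have un: "u < n" using M[OF e(1)] e(2) by auto
    have "ordered (u, v) \<in> insert e (touching n e)"
      using that un by (auto simp: touching_def ordered_def vpairs_def)
    then have "fst (h (ordered (u, v)))" using e(1) by (auto simp: M_def fresh_edge_def)
    then show ?thesis
      using that un by (cases "u < v") (auto simp: edge_iff edge_iff' ordered_def)
  qed
  have uniq: "v = u" if "e \<in> M" "u \<in> {fst e, snd e}" "v < n" "c v = c u" for e u v
  proof (rule ccontr)
    assume "v \<noteq> u"
    then have "{u, v} \<in> edges_of n (fst \<circ> h)" using edge[of e u v] that by auto
    moreover have "u < n" using M[OF that(1)] that(2) by auto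
    ultimately show False using proper[of u v] that \<open>v \<noteq> u\<close> by simp
  qed
  \<comment> \<open>\<open>J\<close> collects the larger ends of the fresh edges, and
    \<open>\<pi>\<close> leads to the smaller ends.\<close>
  define J where "J = snd ` M"
  have inj_snd: "inj_on snd M" using disj by (force simp: inj_on_def)
  define \<pi> where "\<pi> j = fst (the_inv_into M snd j)" for j
  have \<pi>: "(\<pi> j, j) \<in> M" if "j \<in> J" for j
    using that the_inv_into_f_f[OF inj_snd] by (auto simp: J_def \<pi>_def)
  have "chromatic_number n (edges_of n ((\<lambda>(a, b). a \<and> b) \<circ> h)) + card J \<le>
      chromatic_number n (edges_of n (fst \<circ> h))"
  proof (rule chromatic_number_merge[where c = c and \<pi> = \<pi>])
    fix v assume "v < n"
    then show "c v < chromatic_number n (edges_of n (fst \<circ> h))" using c by (auto simp: proper_colouring_def)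
  next
    fix u v assume "u < n" "v < n" "u \<noteq> v" "{u, v} \<in> edges_of n ((\<lambda>(a, b). a \<and> b) \<circ> h)"
    moreover from this have "{u, v} \<in> edges_of n (fst \<circ> h)" by (fastforce simp: edges_of_def)
    ultimately show "c u \<noteq> c v" by (intro proper)
  next
    show "J \<subseteq> {..<n}" using M by (auto simp: J_def)
    show "inj_on \<pi> J"
    proof (rule inj_onI)
      fix j k assume "j \<in> J" "k \<in> J" "\<pi> j = \<pi> k"
      then show "j = k" using disj[OF \<pi>[of j] \<pi>[of k]] by auto
    qed
    show "\<pi> ` J \<subseteq> {..<n} - J"
    proof
      fix i assume "i \<in> \<pi> ` J"
      then obtain j where j: "j \<in> J" "i = \<pi> j" by auto
      have "i \<notin> J"
      proof
        assume "i \<in> J"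
        then show False using disj[OF \<pi>[of j] \<pi>[of i]] M[OF \<pi>[of i]] M[OF \<pi>[of j]] j by auto
      qed
      moreover have "i < n" using M(1,2)[OF \<pi>[OF j(1)]] j(2) by auto
      ultimately show "i \<in> {..<n} - J" by simp
    qed
  next
    fix j v assume "j \<in> J" "v < n" "c v = c j"
    then show "v = j" using uniq[OF \<pi>[of j], of j v] by auto
  next
    fix j v assume "j \<in> J" "v < n" "c v = c (\<pi> j)"
    then show "v = \<pi> j" using uniq[OF \<pi>[of j], of "\<pi> j" v] by auto
  next
    fix j assume "j \<in> J"
    from M[OF \<pi>[OF this]] show "{j, \<pi> j} \<notin> edges_of n ((\<lambda>(a, b). a \<and> b) \<circ> h)"
      by (auto simp: edge_iff')
  qed
  moreover have "card J = card M" unfolding J_def by (rule card_image[OF inj_snd])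
  ultimately show ?thesis by (simp add: M_def)
qed

section \<open>Second moment of the number of fresh edges\<close>

lemma square_le_card_vpairs: "n ^ 2 \<le> 2 * card (vpairs n) + n"
proof -
  have "{..<n} \<times> {..<n} \<subseteq> vpairs n \<union> prod.swap ` vpairs n \<union> (\<lambda>i. (i, i)) ` {..<n}"
  proof
    fix z assume "z \<in> {..<n} \<times> {..<n}"
    then obtain i j where z: "z = (i, j)" "i < n" "j < n" by auto
    consider "i < j" | "i = j" | "j < i" by linarith
    then show "z \<in> vpairs n \<union> prod.swap ` vpairs n \<union> (\<lambda>i. (i, i)) ` {..<n}"
      by cases (use z in \<open>auto simp: vpairs_def image_iff\<close>)
  qed
  then have "card ({..<n} \<times> {..<n}) \<le> card (vpairs n \<union> prod.swap ` vpairs n \<union> (\<lambda>i. (i, i)) ` {..<n})"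
    by (intro card_mono) auto
  also have "\<dots> \<le> card (vpairs n) + card (prod.swap ` vpairs n) + card ((\<lambda>i. (i, i)) ` {..<n})"
    by (meson add_le_mono1 card_Un_le le_trans)
  also have "\<dots> \<le> card (vpairs n) + card (vpairs n) + n"
    using card_image_le[of "vpairs n" prod.swap] card_image_le[of "{..<n}" "\<lambda>i. (i, i)"] by simp
  finally show ?thesis by (simp add: card_cartesian_product power2_eq_square)
qed

lemma card_vpairs_le: "card (vpairs n) \<le> n ^ 2"
proof -
  have "card (vpairs n) \<le> card ({..<n} \<times> {..<n})" by (intro card_mono) (auto simp: vpairs_def)
  then show ?thesis by (simp add: card_cartesian_product power2_eq_square)
qed

text \<open>Chebyshev with \<open>K = 1 / (p * r) ^ 4\<close>: fresh-edge events of intersecting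
  pairs exclude each other, and those of disjoint pairs share at most four constraints. The number
  \<open>\<mu>\<close> only bounds the mean from below, by at least \<open>n ^ 2 / 4\<close> pairs
  with at most \<open>2 * n\<close> touching pairs each.\<close>

lemma prob_few_fresh_edges:
  fixes p r :: real
  assumes n: "n \<ge> 2" and p: "0 < p" "p \<le> 1" and r: "0 < r" "r < 1"
  defines "J \<equiv> Pi_pmf (vpairs n) (False, False) (\<lambda>_. pair_pmf (bernoulli_pmf p) (bernoulli_pmf r))"
  defines "\<mu> \<equiv> real n ^ 2 * (p * (1 - r)) * (p * r) ^ (2 * n) / 4"
  shows "measure_pmf.prob J {h. real (card {e \<in> vpairs n. h \<in> fresh_edge n e}) \<le> \<mu> / 2} \<le>
    4 * (1 / \<mu> + (1 / (p * r) ^ 4 - 1))"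
proof -
  define s where "s = p * r"
  have s: "0 < s" "s \<le> 1" using p r by (auto simp: s_def mult_le_one)
  let ?W = "pair_pmf (bernoulli_pmf p) (bernoulli_pmf r)"
  \<comment> \<open>\<open>D\<close> holds the edges not retained and \<open>B\<close> the retained
    ones; one formula serves for single events and for intersections of two.\<close>
  have prob_in: "measure_pmf.prob J {h. \<forall>x\<in>D \<union> B. h x \<in> (if x \<in> D then {(True, False)} else {(True, True)})}
      = (p * (1 - r)) ^ card D * s ^ card B"
    if "D \<subseteq> vpairs n" "B \<subseteq> vpairs n" "D \<inter> B = {}" for D B
  proof -
    have "finite D" "finite B" using that finite_subset[OF _ finite_vpairs] by blast+
    have *: "x \<notin> D" if "x \<in> B" for x using that \<open>D \<inter> B = {}\<close> by auto
    have "measure_pmf.prob J {h. \<forall>x\<in>D \<union> B. h x \<in> (if x \<in> D then {(True, False)} else {(True, True)})}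
        = (\<Prod>x\<in>D \<union> B. measure_pmf.prob ?W (if x \<in> D then {(True, False)} else {(True, True)}))"
      unfolding J_def using that by (intro prob_Pi_pmf_all_in) auto
    also have "\<dots> = (\<Prod>x\<in>D. measure_pmf.prob ?W {(True, False)}) * (\<Prod>x\<in>B. measure_pmf.prob ?W {(True, True)})"
      using \<open>finite D\<close> \<open>finite B\<close> that(3) by (subst prod.union_disjoint) (auto simp: * intro!: prod.cong)
    finally show ?thesis using p r by (simp add: measure_pmf_single pmf_pair s_def)
  qed
  have Ev: "measure_pmf.prob J (fresh_edge n e) = (p * (1 - r)) * s ^ card (touching n e)"
    if "e \<in> vpairs n" for e
  proof -
    have "fresh_edge n e = {h. \<forall>x\<in>{e} \<union> touching n e. h x \<in> (if x \<in> {e} then {(True, False)} else {(True, True)})}"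
      by (auto simp: fresh_edge_def touching_def)
    then show ?thesis using that by (simp only:, subst prob_in) (auto simp: touching_def)
  qed
  have Ev2: "measure_pmf.prob J (fresh_edge n e \<inter> fresh_edge n e') \<le>
      1 / s ^ 4 * (measure_pmf.prob J (fresh_edge n e) * measure_pmf.prob J (fresh_edge n e'))"
    if e: "e \<in> vpairs n" "e' \<in> vpairs n" "e \<noteq> e'" for e e'
  proof (cases "{fst e, snd e} \<inter> {fst e', snd e'} = {}")
    case False
    then have "fresh_edge n e \<inter> fresh_edge n e' = {}" using fresh_edges_disjoint e by blast
    then show ?thesis using s by simp
  next
    case disj: True
    let ?B = "touching n e" and ?B' = "touching n e'"
    have nin: "x \<noteq> e \<and> x \<noteq> e'" if "x \<in> ?B \<union> ?B'" for x
      using that disj unfolding touching_def by blast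
    have "fresh_edge n e \<inter> fresh_edge n e' =
      {h. \<forall>x\<in>{e, e'} \<union> (?B \<union> ?B'). h x \<in> (if x \<in> {e, e'} then {(True, False)} else {(True, True)})}"
      using nin by (auto simp: fresh_edge_def)
    moreover have "{e, e'} \<inter> (?B \<union> ?B') = {}" using nin by blast
    ultimately have "measure_pmf.prob J (fresh_edge n e \<inter> fresh_edge n e') =
        (p * (1 - r)) ^ card {e, e'} * s ^ card (?B \<union> ?B')"
      using e by (simp only:, intro prob_in) (auto simp: touching_def)
    also have "\<dots> = (p * (1 - r)) ^ 2 * s ^ card (?B \<union> ?B')"
      using e by (simp add: power2_eq_square)
    also have "s ^ card (?B \<union> ?B') \<le> 1 / s ^ 4 * (s ^ card ?B * s ^ card ?B')"
    proof -
      have "s ^ card (?B \<union> ?B') * s ^ 4 \<le> s ^ card (?B \<union> ?B') * s ^ card (?B \<inter> ?B')"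
        using s card_touching_Int_le[OF disj] by (intro mult_left_mono power_decreasing) auto
      also have "\<dots> = s ^ card ?B * s ^ card ?B'"
        by (metis card_Un_Int finite_touching power_add)
      finally show ?thesis using s by (simp add: field_simps)
    qed
    finally show ?thesis using e p r
      by (simp add: Ev power2_eq_square mult_left_mono mult_ac)
  qed
  have pr: "0 < p * (1 - r)" using p r by simp
  define \<nu> where "\<nu> = (\<Sum>e\<in>vpairs n. measure_pmf.prob J (fresh_edge n e))"
  have \<mu>_pos: "\<mu> > 0" using p r n by (simp add: \<mu>_def)
  have "\<mu> \<le> \<nu>"
  proof -
    have "real n ^ 2 / 4 \<le> real (card (vpairs n))"
    proof -
      have "2 * n \<le> n ^ 2" using n by (simp add: power2_eq_square)
      then have "n ^ 2 \<le> 4 * card (vpairs n)" using square_le_card_vpairs[of n] by linarith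
      then have "real (n ^ 2) \<le> real (4 * card (vpairs n))" by (simp only: of_nat_le_iff)
      then show ?thesis by simp
    qed
    then have "real n ^ 2 / 4 * ((p * (1 - r)) * s ^ (2 * n)) \<le>
        real (card (vpairs n)) * ((p * (1 - r)) * s ^ (2 * n))"
      using s pr by (intro mult_right_mono) auto
    also have "\<dots> = (\<Sum>e\<in>vpairs n. (p * (1 - r)) * s ^ (2 * n))" by simp
    also have "\<dots> \<le> \<nu>" unfolding \<nu>_def
      using s pr card_touching_le by (intro sum_mono) (auto simp: Ev intro!: mult_left_mono power_decreasing)
    finally show ?thesis by (simp add: \<mu>_def s_def mult_ac)
  qed
  have "measure_pmf.prob J {h. real (card {e \<in> vpairs n. h \<in> fresh_edge n e}) \<le> \<mu> / 2} \<le>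
      measure_pmf.prob J {h. real (card {e \<in> vpairs n. h \<in> fresh_edge n e}) \<le> \<nu> / 2}"
    using \<open>\<mu> \<le> \<nu>\<close> by (intro measure_pmf.finite_measure_mono) auto
  also have "\<dots> \<le> 4 * (1 / \<nu> + (1 / s ^ 4 - 1))"
    unfolding \<nu>_def using \<open>\<mu> \<le> \<nu>\<close> \<mu>_pos s Ev2
    by (intro chebyshev_card_events) (auto simp: \<nu>_def)
  also have "\<dots> \<le> 4 * (1 / \<mu> + (1 / s ^ 4 - 1))"
    using \<open>\<mu> \<le> \<nu>\<close> \<mu>_pos by (simp add: frac_le)
  finally show ?thesis by (simp add: s_def)
qed

text \<open>The graph and its thinning are coupled. If both chromatic numbers lay in the interval
  and there were more than \<open>\<mu> / 2\<close> fresh edges, they would differ by more than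
  \<open>l\<close>. So three bad events cover the space: the first has probability
  \<open>\<beta>\<close>, the second is compared with \<open>\<beta>\<close> through the likelihood
  ratio, whose exponent \<open>close\<close> keeps at most 1, and the third is the second moment
  bound.\<close>

lemma prob_outside_short_interval:
  fixes p r a l :: real
  assumes n: "n \<ge> 2" and p: "0 < p" "p < 1" and r: "0 < r" "r < 1"
    and close: "real n ^ 2 * (p * (1 - r))\<^sup>2 \<le> p * (1 - p)"
  defines "\<mu> \<equiv> real n ^ 2 * (p * (1 - r)) * (p * r) ^ (2 * n) / 4"
  defines "\<beta> \<equiv> measure_pmf.prob (gnp n p) {E. real (chromatic_number n E) \<notin> {a .. a + l}}"
  assumes l: "l \<le> \<mu> / 2"
  shows "1 \<le> \<beta> + sqrt (exp 1 * \<beta>) + 4 * (1 / \<mu> + (1 / (p * r) ^ 4 - 1))"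
proof -
  let ?J = "Pi_pmf (vpairs n) (False, False) (\<lambda>_. pair_pmf (bernoulli_pmf p) (bernoulli_pmf r))"
  let ?bad = "\<lambda>f. real (chromatic_number n (edges_of n f)) \<notin> {a .. a + l}"
  let ?and = "\<lambda>(a, b). a \<and> b"
  have \<beta>: "\<beta> = measure_pmf.prob (Pi_pmf (vpairs n) False (\<lambda>_. bernoulli_pmf p)) {f. ?bad f}"
    by (simp add: \<beta>_def gnp_eq_map_edges_of vimage_def)
  have 1: "measure_pmf.prob ?J {h. ?bad (fst \<circ> h)} = \<beta>"
  proof -
    have "Pi_pmf (vpairs n) False (\<lambda>_. bernoulli_pmf p) = map_pmf (\<lambda>h. fst \<circ> h) ?J"
      by (subst Pi_pmf_map[symmetric]) (auto simp: map_fst_pair_pmf)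
    then show ?thesis by (simp add: \<beta> vimage_def)
  qed
  have "(measure_pmf.prob ?J {h. ?bad (?and \<circ> h)})\<^sup>2 \<le> exp 1 * \<beta>"
  proof -
    have "Pi_pmf (vpairs n) False (\<lambda>_. bernoulli_pmf (p * r)) = map_pmf (\<lambda>h. ?and \<circ> h) ?J"
      using p r by (subst Pi_pmf_map[symmetric]) (auto simp: map_conj_bernoulli_pmf)
    then have "(measure_pmf.prob ?J {h. ?bad (?and \<circ> h)})\<^sup>2 =
        (measure_pmf.prob (Pi_pmf (vpairs n) False (\<lambda>_. bernoulli_pmf (p * r))) {f. ?bad f})\<^sup>2"
      by (simp add: vimage_def)
    also have "\<dots> \<le> exp (real (card (vpairs n)) * (p - p * r)\<^sup>2 / (p * (1 - p))) * \<beta>"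
      unfolding \<beta> using p r by (intro prob_Pi_bernoulli_contiguous) (auto simp: mult_le_one)
    also have "\<dots> \<le> exp 1 * \<beta>"
    proof -
      have "real (card (vpairs n)) * (p - p * r)\<^sup>2 \<le> real n ^ 2 * (p - p * r)\<^sup>2"
        using card_vpairs_le[of n] by (intro mult_right_mono) (auto simp flip: of_nat_power)
      also have "\<dots> \<le> p * (1 - p)" using close by (simp add: algebra_simps)
      finally show ?thesis using p by (intro mult_right_mono) (auto simp: \<beta>_def divide_simps)
    qed
    finally show ?thesis .
  qed
  then have 2: "measure_pmf.prob ?J {h. ?bad (?and \<circ> h)} \<le> sqrt (exp 1 * \<beta>)"
    by (rule real_le_rsqrt)
  let ?few = "{h. real (card {e \<in> vpairs n. h \<in> fresh_edge n e}) \<le> \<mu> / 2}"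
  have 3: "measure_pmf.prob ?J ?few \<le> 4 * (1 / \<mu> + (1 / (p * r) ^ 4 - 1))"
    unfolding \<mu>_def using n p r by (intro prob_few_fresh_edges) auto
  have cover: "h \<in> {h. ?bad (fst \<circ> h)} \<union> {h. ?bad (?and \<circ> h)} \<union> ?few" for h
  proof (rule ccontr)
    assume "\<not> ?thesis"
    then have "real (chromatic_number n (edges_of n (fst \<circ> h))) \<le> a + l"
      "a \<le> real (chromatic_number n (edges_of n (?and \<circ> h)))"
      "\<mu> / 2 < real (card {e \<in> vpairs n. h \<in> fresh_edge n e})" by auto
    moreover have "real (chromatic_number n (edges_of n (?and \<circ> h))) +
        real (card {e \<in> vpairs n. h \<in> fresh_edge n e}) \<le> real (chromatic_number n (edges_of n (fst \<circ> h)))"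
      using chromatic_number_fresh_edges[of n h] by linarith
    ultimately show False using l by linarith
  qed
  have "{h. ?bad (fst \<circ> h)} \<union> {h. ?bad (?and \<circ> h)} \<union> ?few = UNIV"
    by (rule UNIV_eq_I[symmetric]) (rule cover)
  then have "1 = measure_pmf.prob ?J ({h. ?bad (fst \<circ> h)} \<union> {h. ?bad (?and \<circ> h)} \<union> ?few)"
    by (simp only: measure_pmf_UNIV)
  also have "\<dots> \<le> measure_pmf.prob ?J ({h. ?bad (fst \<circ> h)} \<union> {h. ?bad (?and \<circ> h)}) +
      measure_pmf.prob ?J ?few"
    by (rule measure_Un_le) simp_all
  also have "measure_pmf.prob ?J ({h. ?bad (fst \<circ> h)} \<union> {h. ?bad (?and \<circ> h)}) \<le>
      measure_pmf.prob ?J {h. ?bad (fst \<circ> h)} + measure_pmf.prob ?J {h. ?bad (?and \<circ> h)}"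
    by (rule measure_Un_le) simp_all
  finally show ?thesis using 1 2 3 by linarith
qed

text \<open>The left side is the quantity \<open>\<mu>\<close> above for
  \<open>r = 1 - \<rho>\<close>. Here \<open>n ^ 2 * \<rho> = sqrt (n * \<phi>)\<close>, and the
  power is at least \<open>exp (- 4 * \<phi> - 4 * sqrt (1 - p))\<close>. The 4 in front of
  \<open>\<phi>\<close>, rather than 2, comes from a crude logarithm bound and is harmless for
  \<open>\<phi>\<close> much smaller than \<open>ln n\<close>.\<close>

lemma expected_fresh_edges_lower_bound:
  fixes p :: real
  assumes n: "n \<ge> 2" and p: "3 / 4 \<le> p" "p < 1"
  defines "\<rho> \<equiv> sqrt (1 - p) / real n" and "\<phi> \<equiv> real n * (1 - p)"
  shows "real n ^ 2 * (p * (1 - (1 - \<rho>))) * (p * (1 - \<rho>)) ^ (2 * n) / 4 \<ge>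
    3 / 16 * exp (- 2) * (sqrt (real n * \<phi>) * exp (- 4 * \<phi>))"
proof -
  define q where "q = 1 - p"
  define s where "s = p * (1 - \<rho>)"
  have q: "0 < q" "q \<le> 1 / 4" using p by (auto simp: q_def)
  have sq: "0 < sqrt q" "sqrt q \<le> 1 / 2" using q real_sqrt_le_mono[of q "1 / 4"] by (auto simp: real_sqrt_divide)
  have \<rho>: "0 < \<rho>" "real n * \<rho> = sqrt q" using n sq by (auto simp: \<rho>_def q_def)
  have "\<rho> \<le> 1 / 4"
  proof -
    have "2 * \<rho> \<le> real n * \<rho>" using n \<rho> by (intro mult_right_mono) auto
    then show ?thesis using \<rho> sq by simp
  qed
  have "q * \<rho> \<ge> 0" using q \<rho> by simp
  then have s: "1 - s \<le> q + \<rho>" by (simp add: s_def q_def algebra_simps)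
  have s1: "s \<le> 1" "s > 0" using p \<rho> \<open>\<rho> \<le> 1 / 4\<close> by (auto simp: s_def mult_le_one)
  have half: "0 \<le> 1 - s" "1 - s \<le> 1 / 2" using s s1 q \<open>\<rho> \<le> 1 / 4\<close> by auto
  \<comment> \<open>From \<open>ln (1 - y) \<ge> - y - 2 * y\<^sup>2\<close> for
    \<open>y = 1 - s\<close>, where \<open>y \<le> 1 / 2\<close> absorbs the square.\<close>
  have "- 2 * (1 - s) \<le> ln s"
  proof -
    have "(1 - s)\<^sup>2 \<le> (1 - s) * (1 / 2)" unfolding power2_eq_square using half by (intro mult_left_mono) auto
    then show ?thesis using ln_one_minus_pos_lower_bound[OF half] by simp
  qed
  then have "real (2 * n) * (- 2 * (q + \<rho>)) \<le> real (2 * n) * ln s"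
    using s by (intro mult_left_mono) auto
  moreover have "real (2 * n) * (- 2 * (q + \<rho>)) = - 4 * \<phi> - 4 * sqrt q"
    using \<rho>(2) by (simp add: \<phi>_def q_def algebra_simps)
  ultimately have "exp (- 4 * \<phi> - 2) \<le> exp (real (2 * n) * ln s)"
    using sq by simp
  also have "\<dots> = s ^ (2 * n)" using s1 by (simp only: exp_of_nat_mult exp_ln)
  finally have pow: "exp (- 4 * \<phi> - 2) \<le> s ^ (2 * n)" .
  have root: "real n ^ 2 * \<rho> = sqrt (real n * \<phi>)"
  proof -
    have "real n ^ 2 * \<rho> = real n * sqrt q" using \<rho>(2) by (simp add: power2_eq_square)
    also have "\<dots> = sqrt (real n ^ 2 * q)" by (simp add: real_sqrt_mult)
    finally show ?thesis by (simp add: \<phi>_def q_def power2_eq_square)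
  qed
  have \<phi>: "0 \<le> \<phi>" using q by (simp add: \<phi>_def q_def)
  have "3 / 16 * exp (- 2) * (sqrt (real n * \<phi>) * exp (- 4 * \<phi>)) =
      (sqrt (real n * \<phi>) * (3 / 4)) * exp (- 4 * \<phi> - 2) / 4"
    by (simp add: exp_diff exp_minus field_simps)
  also have "\<dots> \<le> (sqrt (real n * \<phi>) * p) * s ^ (2 * n) / 4"
    using pow p \<phi> by (intro divide_right_mono mult_mono mult_left_mono) auto
  also have "\<dots> = real n ^ 2 * (p * (1 - (1 - \<rho>))) * (p * (1 - \<rho>)) ^ (2 * n) / 4"
    unfolding root[symmetric] s_def by (simp add: mult_ac)
  finally show ?thesis .
qed

text \<open>If the intervals had probability tending to 1, the right side \<open>R n\<close> of the
  covering inequality would tend to 0, although it is eventually at least 1.\<close>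

lemma chromatic_number_not_concentrated:
  fixes \<epsilon> :: real and p a :: "nat \<Rightarrow> real"
  assumes eps: "\<epsilon> > 0" and p: "\<And>n. 0 \<le> p n \<and> p n \<le> 1"
    and \<eta>: "\<eta> \<longlonglongrightarrow> 0" and lower: "\<forall>\<^sub>F n in sequentially. real n powr (- \<eta> n) \<le> real n * (1 - p n)"
    and upper: "(\<lambda>n. real n * (1 - p n) / ln (real n)) \<longlonglongrightarrow> 0"
    and conc: "(\<lambda>n. measure_pmf.prob (gnp n (p n))
      {E. real (chromatic_number n E) \<in> {a n .. a n + real_of_int \<lfloor>real n powr (1/2 - \<epsilon>)\<rfloor>}}) \<longlonglongrightarrow> 1"
  shows False
proof -
  \<comment> \<open>Capping at \<open>1 / 4\<close> keeps \<open>1/2 - e \<ge> 1/4\<close>, so that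
    the number of fresh edges diverges even for large \<open>\<epsilon>\<close>.\<close>
  define e where "e = min \<epsilon> (1 / 4)"
  have e: "0 < e" "e \<le> \<epsilon>" "e \<le> 1 / 4" using eps by (auto simp: e_def)
  define l where "l n = real_of_int \<lfloor>real n powr (1/2 - \<epsilon>)\<rfloor>" for n
  define \<beta> where "\<beta> n = measure_pmf.prob (gnp n (p n))
    {E. real (chromatic_number n E) \<notin> {a n .. a n + l n}}" for n
  have \<beta>: "\<beta> \<longlonglongrightarrow> 0"
    using tendsto_diff[OF tendsto_const[of 1] conc] unfolding \<beta>_def l_def prob_compl_Collect by simp
  define r where "r n = 1 - sqrt (1 - p n) / real n" for n
  have q: "(\<lambda>n. 1 - p n) \<longlonglongrightarrow> 0"
  proof -
    have "(\<lambda>n. ln (real n) / real n) \<longlonglongrightarrow> 0" by real_asymp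
    then have "(\<lambda>n. real n * (1 - p n) / ln (real n) * (ln (real n) / real n)) \<longlonglongrightarrow> 0"
      using tendsto_mult[OF upper] by fastforce
    then show ?thesis
    proof (rule Lim_transform_eventually)
      show "\<forall>\<^sub>F n in sequentially. real n * (1 - p n) / ln (real n) * (ln (real n) / real n) = 1 - p n"
        using eventually_ge_at_top[of 2] by eventually_elim simp
    qed
  qed
  have p_lim: "p \<longlonglongrightarrow> 1" using tendsto_diff[OF tendsto_const[of 1] q] by simp
  have inv_n: "(\<lambda>n. 1 / real n) \<longlonglongrightarrow> 0" by real_asymp
  have r_lim: "r \<longlonglongrightarrow> 1"
  proof -
    have "(\<lambda>n. 1 - sqrt (1 - p n) * (1 / real n)) \<longlonglongrightarrow> 1 - sqrt 0 * 0"
      by (intro tendsto_intros q inv_n)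
    then show ?thesis by (simp add: r_def[abs_def])
  qed
  define R where "R n = \<beta> n + sqrt (exp 1 * \<beta> n) +
    4 * (1 / (2 * real n powr (1/4)) + (1 / (p n * r n) ^ 4 - 1))" for n
  have "(\<lambda>n. 1 / (2 * real n powr (1/4))) \<longlonglongrightarrow> 0" by real_asymp
  then have "R \<longlonglongrightarrow> 0 + sqrt (exp 1 * 0) + 4 * (0 + (1 / (1 * 1) ^ 4 - 1))"
    unfolding R_def[abs_def] by (intro tendsto_intros \<beta> p_lim r_lim) auto
  then have R_lim: "R \<longlonglongrightarrow> 0" by simp
  have "\<forall>\<^sub>F n in sequentially. 1 \<le> R n"
  proof -
    \<comment> \<open>The thresholds are split so that \<open>exp (- 4 * ?\<phi>)\<close> and
      \<open>sqrt (n * ?\<phi>)\<close> each lose a factor of at most \<open>n powr (e / 4)\<close>.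
      A factor \<open>n powr (e / 2)\<close> is left to absorb the constants.\<close>
    have "\<forall>\<^sub>F n in sequentially. real n * (1 - p n) / ln (real n) < e / 16"
      using order_tendstoD(2)[OF upper, of "e / 16"] e by simp
    moreover have "\<forall>\<^sub>F n in sequentially. \<eta> n < e / 2"
      using order_tendstoD(2)[OF \<eta>, of "e / 2"] e by simp
    moreover have "\<forall>\<^sub>F n in sequentially. 3 / 4 < p n"
      using order_tendstoD(1)[OF p_lim, of "3 / 4"] by simp
    moreover have "\<forall>\<^sub>F n in sequentially.
        2 * real n powr (1/2 - e) \<le> 3 / 16 * exp (- 2) * real n powr (1/2 - e / 2)"
      using e by real_asymp
    moreover have "\<forall>\<^sub>F n in sequentially. n \<ge> (2 :: nat)" by (rule eventually_ge_at_top)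
    ultimately show ?thesis using lower
    proof eventually_elim
      case (elim n)
      let ?\<phi> = "real n * (1 - p n)"
      define \<mu> where "\<mu> = real n ^ 2 * (p n * (1 - r n)) * (p n * r n) ^ (2 * n) / 4"
      have n: "n \<ge> 2" by fact
      have "0 < real n powr (- \<eta> n)" using n by simp
      then have \<phi>: "0 < ?\<phi>" using elim(6) by linarith
      then have p1: "p n < 1" using n by (simp add: zero_less_mult_iff)
      have sq: "0 < sqrt (1 - p n)" "sqrt (1 - p n) \<le> 1" using p1 p[of n] by auto
      moreover have "sqrt (1 - p n) < real n" using sq n by linarith
      ultimately have r: "0 < r n" "r n < 1" using n unfolding r_def by (simp_all add: field_simps)
      have "\<mu> \<ge> 3 / 16 * exp (- 2) * (sqrt (real n * ?\<phi>) * exp (- 4 * ?\<phi>))"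
        unfolding \<mu>_def r_def using expected_fresh_edges_lower_bound[OF n, of "p n"] elim(3) p1 by simp
      moreover have root: "real n powr (1/2 - e / 4) \<le> sqrt (real n * ?\<phi>)"
      proof -
        have "real n powr (- e / 2) \<le> real n powr (- \<eta> n)" using n elim(2) by (intro powr_mono) auto
        also have "\<dots> \<le> ?\<phi>" by fact
        finally have "real n powr 1 * real n powr (- e / 2) \<le> real n * ?\<phi>"
          using n by (simp add: mult_left_mono)
        then have "real n powr (1 - e / 2) \<le> real n * ?\<phi>" unfolding powr_add[symmetric] by simp
        then have "sqrt (real n powr (1 - e / 2)) \<le> sqrt (real n * ?\<phi>)" by (rule real_sqrt_le_mono)
        moreover have "sqrt (real n powr (1 - e / 2)) = real n powr (1/2 - e / 4)"
          by (simp add: powr_half_sqrt[symmetric] powr_powr field_simps)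
        ultimately show ?thesis by simp
      qed
      moreover have "real n powr (- e / 4) \<le> exp (- 4 * ?\<phi>)"
      proof -
        have "0 < ln (real n)" using n by simp
        then have "?\<phi> \<le> e / 16 * ln (real n)" using elim(1) by (simp add: pos_divide_less_eq less_imp_le)
        then show ?thesis using n by (simp add: powr_def)
      qed
      then have "real n powr (1/2 - e / 4) * real n powr (- e / 4) \<le> sqrt (real n * ?\<phi>) * exp (- 4 * ?\<phi>)"
        using root \<phi> by (intro mult_mono) auto
      then have "3 / 16 * exp (- 2) * (real n powr (1/2 - e / 4) * real n powr (- e / 4)) \<le>
          3 / 16 * exp (- 2) * (sqrt (real n * ?\<phi>) * exp (- 4 * ?\<phi>))"
        by (intro mult_left_mono) auto
      ultimately have "\<mu> \<ge> 3 / 16 * exp (- 2) * (real n powr (1/2 - e / 4) * real n powr (- e / 4))"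
        by linarith
      also have "real n powr (1/2 - e / 4) * real n powr (- e / 4) = real n powr (1/2 - e / 2)"
        by (simp flip: powr_add)
      finally have \<mu>: "2 * real n powr (1/2 - e) \<le> \<mu>" using elim(4) by linarith
      have "l n \<le> real n powr (1/2 - \<epsilon>)" unfolding l_def by linarith
      also have "\<dots> \<le> real n powr (1/2 - e)" using e n by (intro powr_mono) auto
      finally have l: "l n \<le> \<mu> / 2" using \<mu> by simp
      have "real n powr (1/4) \<le> real n powr (1/2 - e)" using e n by (intro powr_mono) auto
      then have \<mu>': "2 * real n powr (1/4) \<le> \<mu>" using \<mu> by simp
      \<comment> \<open>This dictates the choice of \<open>r\<close>: the thinning probability
        \<open>sqrt (1 - p n) / n\<close> has the largest order for which the two graphs remain
        comparable.\<close>
      have "real n ^ 2 * (p n * (1 - r n))\<^sup>2 = (p n)\<^sup>2 * (1 - p n)"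
        using n p1 by (simp add: r_def power_mult_distrib power_divide)
      also have "\<dots> \<le> p n * (1 - p n)"
        using p[of n] by (intro mult_right_mono) (auto simp: power2_eq_square mult_left_le)
      finally have close: "real n ^ 2 * (p n * (1 - r n))\<^sup>2 \<le> p n * (1 - p n)" .
      have "1 \<le> \<beta> n + sqrt (exp 1 * \<beta> n) + 4 * (1 / \<mu> + (1 / (p n * r n) ^ 4 - 1))"
        unfolding \<mu>_def \<beta>_def
        using prob_outside_short_interval[OF n _ p1 r close] l elim(3) unfolding \<mu>_def by simp
      also have "1 / \<mu> \<le> 1 / (2 * real n powr (1/4))"
        using \<mu>' n by (intro divide_left_mono mult_pos_pos) (auto intro: less_le_trans[rotated])
      finally show ?case unfolding R_def by simp
    qed
  qed
  then have "(1 :: real) \<le> 0"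
    using R_lim by (intro tendsto_lowerbound[of R 0 sequentially 1]) auto
  then show False by simp
qed

theorem theorem2:
  fixes \<epsilon> :: real and p :: "nat \<Rightarrow> real"
  assumes eps: "\<epsilon> > 0"
    and p_range: "\<And>n. 0 \<le> p n \<and> p n \<le> 1"
  defines "\<phi> \<equiv> (\<lambda>n. real n * (1 - p n))"
  shows
    "((\<exists>\<eta> :: nat \<Rightarrow> real. \<eta> \<longlonglongrightarrow> 0 \<and>
          (\<forall>\<^sub>F n in sequentially. real n powr (- \<eta> n) \<le> \<phi> n)) \<and>
      (\<lambda>n. \<phi> n / ln (real n)) \<longlonglongrightarrow> 0
      \<longrightarrow> \<not> (\<exists>a :: nat \<Rightarrow> real.
              (\<lambda>n. measure_pmf.prob (gnp n (p n))
                 {E. real (chromatic_number n E) \<in>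
                     {a n .. a n + real_of_int \<lfloor>real n powr (1/2 - \<epsilon>)\<rfloor>}})
              \<longlonglongrightarrow> 1))
     \<and>
     ((\<lambda>n. ln (real n) / \<phi> n) \<longlonglongrightarrow> 0 \<and>
      (\<exists>\<eta> :: nat \<Rightarrow> real. \<eta> \<longlonglongrightarrow> 0 \<and>
          (\<forall>\<^sub>F n in sequentially. \<phi> n \<le> real n powr (\<eta> n)))
      \<longrightarrow> (\<exists>a :: nat \<Rightarrow> real.
              (\<lambda>n. measure_pmf.prob (gnp n (p n))
                 {E. real (chromatic_number n E) \<in>
                     {a n .. a n + real_of_int \<lfloor>real n powr \<epsilon>\<rfloor>}})
              \<longlonglongrightarrow> 1))"
  unfolding \<phi>_def
  using chromatic_number_not_concentrated[where p = p, OF eps p_range] chromatic_number_concentrated[where p = p, OF eps p_range]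
  by blast

end
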